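(* Let $1<\alpha<2$. Let $u\in C^{[\alpha]+4}(\mathbb{R})$ be such that all derivatives of $u$ up to order $[\alpha]+5$ belong to $L_1(\mathbb{R})$. Then, as $h\to 0^+$, $$ {}^{L}\mathcal{B}_{2}^{\alpha}u(x)=\mathcal{L}\,{}_{RL}D_{-\infty,x}^{\alpha}u(x)+\mathcal{O}(h^3)$$ and $$ {}^{R}\mathcal{B}_{2}^{\alpha}u(x)=\mathcal{L}\,{}_{RL}D_{x,+\infty}^{\alpha}u(x)+\mathcal{O}(h^3)$$ uniformly for $x\in\mathbb{R}$.
   Context: $[\alpha]$ is the integer part of $\alpha$; $h>0$ is the step size. For $1<\alpha<2$ the left and right Riemann-Liouville derivatives on $\mathbb{R}$ are $${}_{RL}D_{-\infty,x}^{\alpha}u(x)=\frac{1}{\Gamma(2-\alpha)}\frac{d^2}{dx^2}\int_{-\infty}^{x}\frac{u(s)\,ds}{(x-s)^{\alpha-1}},\qquad {}_{RL}D_{x,+\infty}^{\alpha}u(x)=\frac{1}{\Gamma(2-\alpha)}\frac{d^2}{dx^2}\int_{x}^{+\infty}\frac{u(s)\,ds}{(s-x)^{\alpha-1}}.$$ The coefficients $\kappa_{2,\ell}^{(\alpha)}$ are defined by $$\left(\frac{3\alpha-2}{2\alpha}-\frac{2(\alpha-1)}{\alpha}z+\frac{\alpha-2}{2\alpha}z^2\right)^{\alpha}=\sum_{\ell=0}^{\infty}\kappa_{2,\ell}^{(\alpha)}z^\ell,\quad |z|<1.$$ The difference operators are $${}^{L}\mathcal{B}_{2}^{\alpha}u(x)=\frac{1}{h^{\alpha}}\sum_{\ell=0}^{\infty}\kappa_{2,\ell}^{(\alpha)}u(x-(\ell-1)h),\qquad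 {}^{R}\mathcal{B}_{2}^{\alpha}u(x)=\frac{1}{h^{\alpha}}\sum_{\ell=0}^{\infty}\kappa_{2,\ell}^{(\alpha)}u(x+(\ell-1)h).$$ The operator $\mathcal{L}$ is $\mathcal{L}v(x)=(1+\sigma_2^{(\alpha)}h^2\delta_x^2)v(x)$, where $\delta_x^2v(x)=\frac{v(x+h)-2v(x)+v(x-h)}{h^2}$ and $\sigma_2^{(\alpha)}=-\frac{2\alpha^2-6\alpha+3}{6\alpha}$. *)

theory Defs
  imports "HOL-Complex_Analysis.Complex_Analysis"
begin

definition C_k :: "nat \<Rightarrow> (real \<Rightarrow> real) \<Rightarrow> bool" where
  "C_k k u \<longleftrightarrow> (\<forall>j<k. \<forall>x. ((deriv ^^ j) u) differentiable (at x)) \<and>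
             continuous_on UNIV ((deriv ^^ k) u)"

text \<open>
  All derivatives of \<open>u\<close> of order \<open>0, \<dots>, m\<close> belong to \<open>L\<^sub>1(\<real>)\<close>.
  \<open>D j\<close> is the \<open>j\<close>-th derivative; \<open>D (Suc j)\<close> is the derivative of \<open>D j\<close> in
  the sense of local absolute continuity, i.e. the fundamental theorem of calculus holds. For
  \<open>j < m\<close> this forces \<open>D j\<close> to be the classical derivative \<open>(deriv ^^ j) u\<close>. Only the top
  derivative \<open>D m\<close> is understood up to null sets, so a function of class \<open>C\<^sup>m\<^sup>-\<^sup>1\<close> is not
  required to be \<open>m\<close> times differentiable everywhere.
\<close>

definition derivs_in_L1 :: "nat \<Rightarrow> (real \<Rightarrow> real) \<Rightarrow> bool" where
  "derivs_in_L1 m u \<longleftrightarrow>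
     (\<exists>D :: nat \<Rightarrow> real \<Rightarrow> real. D 0 = u \<and>
        (\<forall>j\<le>m. integrable lborel (D j)) \<and>
        (\<forall>j<m. \<forall>a b. a \<le> b \<longrightarrow>
            D j b - D j a = set_lebesgue_integral lborel {a..b} (D (Suc j))))"

definition RL_left :: "real \<Rightarrow> (real \<Rightarrow> real) \<Rightarrow> real \<Rightarrow> real" where
  "RL_left \<alpha> u x = 1 / Gamma (2 - \<alpha>) *
     (deriv ^^ 2) (\<lambda>y. set_lebesgue_integral lborel {..y}
                          (\<lambda>s. u s / (y - s) powr (\<alpha> - 1))) x"

definition RL_right :: "real \<Rightarrow> (real \<Rightarrow> real) \<Rightarrow> real \<Rightarrow> real" where
  "RL_right \<alpha> u x = 1 / Gamma (2 - \<alpha>) *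
     (deriv ^^ 2) (\<lambda>y. set_lebesgue_integral lborel {y..}
                          (\<lambda>s. u s / (s - y) powr (\<alpha> - 1))) x"

definition gen2 :: "real \<Rightarrow> complex \<Rightarrow> complex" where
  "gen2 \<alpha> z = of_real ((3 * \<alpha> - 2) / (2 * \<alpha>)) - of_real (2 * (\<alpha> - 1) / \<alpha>) * z
              + of_real ((\<alpha> - 2) / (2 * \<alpha>)) * z\<^sup>2"

text \<open>
  The power is the principal branch; for \<open>1 < \<alpha> < 2\<close> the polynomial maps the unit disc into
  the slit plane. That the description below determines a unique sequence is shown in
  \<open>kappa2_sums\<close> and \<open>kappa2_unique\<close>.
\<close>

definition kappa2 :: "real \<Rightarrow> nat \<Rightarrow> real" where
  "kappa2 \<alpha> = (THE k. \<forall>z::complex. norm z < 1 \<longrightarrow>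
                  (\<lambda>l. of_real (k l) * z ^ l) sums (gen2 \<alpha> z powr of_real \<alpha>))"

definition B2_left :: "real \<Rightarrow> real \<Rightarrow> (real \<Rightarrow> real) \<Rightarrow> real \<Rightarrow> real" where
  "B2_left \<alpha> h u x = 1 / h powr \<alpha> * (\<Sum>l. kappa2 \<alpha> l * u (x - (real l - 1) * h))"

definition B2_right :: "real \<Rightarrow> real \<Rightarrow> (real \<Rightarrow> real) \<Rightarrow> real \<Rightarrow> real" where
  "B2_right \<alpha> h u x = 1 / h powr \<alpha> * (\<Sum>l. kappa2 \<alpha> l * u (x + (real l - 1) * h))"

definition sigma2 :: "real \<Rightarrow> real" where
  "sigma2 \<alpha> = - ((2 * \<alpha>\<^sup>2 - 6 * \<alpha> + 3) / (6 * \<alpha>))"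

definition delta2 :: "real \<Rightarrow> (real \<Rightarrow> real) \<Rightarrow> real \<Rightarrow> real" where
  "delta2 h v x = (v (x + h) - 2 * v x + v (x - h)) / h\<^sup>2"

definition L_op :: "real \<Rightarrow> real \<Rightarrow> (real \<Rightarrow> real) \<Rightarrow> real \<Rightarrow> real" where
  "L_op \<alpha> h v x = v x + sigma2 \<alpha> * h\<^sup>2 * delta2 h v x"

lemma gen2_factor:
  assumes "\<alpha> \<noteq> 0"
  shows "gen2 \<alpha> z = (1 - z) * (of_real ((3 * \<alpha> - 2) / (2 * \<alpha>)) + of_real ((2 - \<alpha>) / (2 * \<alpha>)) * z)"
proof -
  define a c where "a = (3 * \<alpha> - 2) / (2 * \<alpha>)" and "c = (2 - \<alpha>) / (2 * \<alpha>)"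
  have 1: "(\<alpha> - 2) / (2 * \<alpha>) = - c" and 2: "2 * (\<alpha> - 1) / \<alpha> = a - c"
    using assms by (auto simp: a_def c_def field_simps)
  show ?thesis
    unfolding gen2_def 1 2 a_def[symmetric] c_def[symmetric]
    by (simp add: algebra_simps power2_eq_square)
qed

lemma gen2_slit:
  assumes "1 < \<alpha>" "\<alpha> < 2" "norm z < 1"
  shows "gen2 \<alpha> z \<notin> \<real>\<^sub>\<le>\<^sub>0"
proof
  define a c where "a = (3 * \<alpha> - 2) / (2 * \<alpha>)" and "c = (2 - \<alpha>) / (2 * \<alpha>)"
  define v w where "v = 1 - z" and "w = of_real a + of_real c * z"
  have c: "0 < c" "c < a" using assms by (auto simp: a_def c_def field_simps)
  have z: "\<bar>Re z\<bar> < 1" using abs_Re_le_cmod[of z] assms by linarith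
  have v: "Re v > 0" using z by (auto simp: v_def)
  have "c * Re z \<ge> c * (-1)" using z c by (intro mult_left_mono) auto
  then have w: "Re w > 0" using c by (simp add: w_def)
  assume "gen2 \<alpha> z \<in> \<real>\<^sub>\<le>\<^sub>0"
  then have "v * w \<in> \<real>\<^sub>\<le>\<^sub>0"
    using gen2_factor[of \<alpha> z] assms by (simp add: v_def w_def a_def c_def)
  then have re: "Re v * Re w - Im v * Im w \<le> 0" and im: "Re v * Im w + Im v * Re w = 0"
    by (auto simp: complex_nonpos_Reals_iff)
  have "Re v * (Re w * Re w + Im w * Im w)
        = (Re v * Re w - Im v * Im w) * Re w + (Re v * Im w + Im v * Re w) * Im w"
    by (simp add: algebra_simps)
  also have "\<dots> \<le> 0" using re im w by (simp add: mult_nonpos_nonneg)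
  finally show False
    using mult_pos_pos[OF v add_pos_nonneg[OF mult_pos_pos[OF w w] zero_le_square[of "Im w"]]] by linarith
qed

lemma kappa2_ex1:
  assumes "1 < \<alpha>" "\<alpha> < 2"
  shows "\<exists>!k::nat \<Rightarrow> real. \<forall>z::complex. norm z < 1 \<longrightarrow>
           (\<lambda>l. of_real (k l) * z ^ l) sums (gen2 \<alpha> z powr of_real \<alpha>)"
proof -
  define f where "f = (\<lambda>z. gen2 \<alpha> z powr of_real \<alpha>)"
  have uniq: "a = b"
    if a: "\<And>z. norm z < 1 \<Longrightarrow> (\<lambda>l. a l * z ^ l) sums f z"
      and b: "\<And>z. norm z < 1 \<Longrightarrow> (\<lambda>l. b l * z ^ l) sums f z" for a b :: "nat \<Rightarrow> complex"
  proof -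
    have ev: "eventually (\<lambda>z::complex. norm z < 1) (nhds 0)"
      using eventually_nhds_in_open[of "ball 0 1" "0::complex"] by (simp add: dist_norm)
    have "f has_fps_expansion Abs_fps a"
      by (rule has_fps_expansionI, rule eventually_mono[OF ev]) (simp add: a)
    moreover have "f has_fps_expansion Abs_fps b"
      by (rule has_fps_expansionI, rule eventually_mono[OF ev]) (simp add: b)
    ultimately have "Abs_fps a = Abs_fps b"
      by (rule fps_expansion_unique_complex)
    then have "fps_nth (Abs_fps a) = fps_nth (Abs_fps b)" by simp
    then show ?thesis by (simp add: fun_eq_iff)
  qed
  have hol: "f holomorphic_on ball 0 1"
    unfolding f_def
  proof (rule holomorphic_on_powr)
    show "gen2 \<alpha> holomorphic_on ball 0 1"
      unfolding gen2_def by (intro holomorphic_intros)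
  qed (use gen2_slit assms in \<open>auto simp: dist_norm\<close>)
  obtain a where a: "\<And>z. norm z < 1 \<Longrightarrow> (\<lambda>l. a l * z ^ l) sums f z"
  proof (rule that[of "\<lambda>n. (deriv ^^ n) f 0 / fact n"])
    fix z :: complex assume "norm z < 1"
    then show "(\<lambda>l. (deriv ^^ l) f 0 / fact l * z ^ l) sums f z"
      using holomorphic_power_series[of f 0 1 z] hol by simp
  qed
  have cnj_f: "f (cnj z) = cnj (f z)" if "norm z < 1" for z
  proof -
    have "cnj (gen2 \<alpha> z powr of_real \<alpha>) = cnj (gen2 \<alpha> z) powr cnj (of_real \<alpha>)"
      using gen2_slit[OF assms that]
      by (intro cnj_powr) (auto simp: complex_nonpos_Reals_iff)
    then show ?thesis by (simp add: f_def gen2_def)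
  qed
  have "(\<lambda>l. cnj (a l)) = a"
  proof (rule uniq[OF _ a])
    fix z :: complex assume "norm z < 1"
    then have "(\<lambda>l. cnj (a l * cnj z ^ l)) sums cnj (f (cnj z))"
      using a[of "cnj z"] by (simp only: sums_cnj complex_mod_cnj)
    then show "(\<lambda>l. cnj (a l) * z ^ l) sums f z"
      using cnj_f[OF \<open>norm z < 1\<close>] by simp
  qed
  then have re: "of_real (Re (a l)) = a l" for l
    by (auto simp: complex_eq_iff dest!: fun_cong[of _ _ l])
  show ?thesis
  proof (rule ex1I[of _ "\<lambda>l. Re (a l)"])
    show "\<forall>z. norm z < 1 \<longrightarrow>
            (\<lambda>l. of_real (Re (a l)) * z ^ l) sums (gen2 \<alpha> z powr of_real \<alpha>)"
      using a by (simp add: re f_def)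
  next
    fix k :: "nat \<Rightarrow> real"
    assume "\<forall>z::complex. norm z < 1 \<longrightarrow>
              (\<lambda>l. of_real (k l) * z ^ l) sums (gen2 \<alpha> z powr of_real \<alpha>)"
    then have "(\<lambda>l. complex_of_real (k l)) = a"
      by (intro uniq) (use a in \<open>auto simp: f_def\<close>)
    then show "k = (\<lambda>l. Re (a l))" by auto
  qed
qed

lemma kappa2_sums:
  assumes "1 < \<alpha>" "\<alpha> < 2" "norm (z::complex) < 1"
  shows "(\<lambda>l. of_real (kappa2 \<alpha> l) * z ^ l) sums (gen2 \<alpha> z powr of_real \<alpha>)"
  using theI'[OF kappa2_ex1[OF assms(1,2)]] assms(3) unfolding kappa2_def by blast

lemma kappa2_unique:
  assumes "1 < \<alpha>" "\<alpha> < 2"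
    and "\<And>z::complex. norm z < 1 \<Longrightarrow>
           (\<lambda>l. of_real (k l) * z ^ l) sums (gen2 \<alpha> z powr of_real \<alpha>)"
  shows "kappa2 \<alpha> = k"
  unfolding kappa2_def using kappa2_ex1[OF assms(1,2)] assms(3) by (intro the1_equality) auto

end

theory Submission
  imports Defs "HOL-Probability.Probability"
begin

text \<open>
  The proof works on the Fourier side. Six integrable derivatives make the Fourier transform of
  \<open>u\<close> decay like \<open>\<bar>w\<bar>\<^sup>-\<^sup>6\<close> (\<open>derivs_in_L1_fourier_decay\<close>), so that
  \<open>u x = \<integral> \<phi> w cis (w x) dw\<close> with \<open>\<bar>\<phi> w\<bar> \<le> M / (1 + \<bar>w\<bar>)\<^sup>6\<close>
  (\<open>fourier_inversion\<close>). Every operator in the statement then acts as a Fourier multiplier: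

  \<^item> the left Riemann-Liouville derivative multiplies \<open>\<phi> w\<close> by \<open>(\<i> w)\<^sup>\<alpha>\<close>
    (\<open>RL_left_fourier\<close>), because the Laplace transform of \<open>t\<^sup>1\<^sup>-\<^sup>\<alpha>\<close> is
    \<open>\<Gamma>(2 - \<alpha>) z\<^sup>\<alpha>\<^sup>-\<^sup>2\<close>;
  \<^item> applying \<open>L_op\<close> multiplies in addition by \<open>1 + \<sigma> (cis (w h) - 2 + cis (- w h))\<close>;
  \<^item> \<open>B2_left\<close> multiplies by \<open>h\<^sup>-\<^sup>\<alpha> cis (w h) W(cis (- w h))\<^sup>\<alpha>\<close> with
    \<open>W = gen2 \<alpha>\<close> (\<open>B2_left_fourier\<close>); this uses that the coefficients are
    absolutely summable, so that their generating function is known on the closed disc.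

  With \<open>s = \<i> w h\<close> the error multiplier is \<open>h\<^sup>-\<^sup>\<alpha>\<close> times
  \<open>e\<^sup>s W(e\<^sup>-\<^sup>s)\<^sup>\<alpha> - s\<^sup>\<alpha> (1 + \<sigma> (e\<^sup>s - 2 + e\<^sup>-\<^sup>s))\<close>. Factoring
  \<open>W z = (1 - z) (a + c z)\<close> and taking logarithms shows that
  \<open>e\<^sup>s W(e\<^sup>-\<^sup>s)\<^sup>\<alpha> / s\<^sup>\<alpha> = 1 + \<sigma> s\<^sup>2 + O(s\<^sup>3)\<close>: the linear term vanishes by the
  choice of \<open>W\<close>, and the quadratic coefficient is \<open>\<sigma> = sigma2 \<alpha>\<close>. Since the error is
  also \<open>O(\<bar>s\<bar>\<^sup>\<alpha>)\<close> for large \<open>s\<close>, it is at most \<open>C \<bar>s\<bar>\<^sup>\<alpha>\<^sup>+\<^sup>3\<close> on the whole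
  imaginary axis (\<open>symbol_estimate\<close>), and the total error is at most
  \<open>C h\<^sup>3 \<integral> \<bar>\<phi> w\<bar> \<bar>w\<bar>\<^sup>\<alpha>\<^sup>+\<^sup>3 dw\<close>. This integral is finite because
  \<open>\<alpha> + 3 - 6 < -1\<close>; here the sixth derivative is needed. The right-sided operators are the
  left-sided ones applied to \<open>x \<mapsto> u (- x)\<close> and evaluated at \<open>- x\<close>.
\<close>

section \<open>Integration tools\<close>

lemma lborel_fubini_bounded_kernel:
  fixes f g :: "real \<Rightarrow> complex" and k :: "real \<Rightarrow> real \<Rightarrow> complex"
  assumes f: "integrable lborel f" and g: "integrable lborel g"
    and k: "(\<lambda>(x, y). k x y) \<in> borel_measurable (lborel \<Otimes>\<^sub>M lborel)"
    and bound: "\<And>x y. norm (k x y) \<le> C"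
  shows "(LINT y|lborel. LINT x|lborel. f x * g y * k x y) =
         (LINT x|lborel. LINT y|lborel. f x * g y * k x y)"
proof (rule lborel_pair.Fubini_integral)
  have [measurable]: "f \<in> borel_measurable lborel" "g \<in> borel_measurable lborel"
    using f g by auto
  have kx [measurable]: "(\<lambda>y. k x y) \<in> borel_measurable lborel" for x
    using measurable_compose_Pair1[OF _ k, of x] by simp
  note [measurable] = k
  have "C \<ge> 0" using bound[of 0 0] norm_ge_zero order_trans by blast
  have le: "norm (f x * g y * k x y) \<le> norm (f x) * C * norm (g y)" for x y
  proof -
    have "norm (f x * g y * k x y) \<le> norm (f x * g y) * C"
      unfolding norm_mult[of "f x * g y"] by (intro mult_left_mono bound) auto
    then show ?thesis by (simp add: norm_mult mult_ac)
  qed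
  have inner: "integrable lborel (\<lambda>y. f x * g y * k x y)" for x
    by (rule Bochner_Integration.integrable_bound[of _ "\<lambda>y. norm (f x) * C * norm (g y)"])
       (use g le \<open>C \<ge> 0\<close> in auto)
  have meas: "(\<lambda>(x, y). f x * g y * k x y) \<in> borel_measurable (lborel \<Otimes>\<^sub>M lborel)"
  proof -
    have "(\<lambda>p. f (fst p) * g (snd p) * (case p of (x, y) \<Rightarrow> k x y))
            \<in> borel_measurable (lborel \<Otimes>\<^sub>M lborel)"
      by measurable
    then show ?thesis by (simp add: case_prod_beta)
  qed
  show "integrable (lborel \<Otimes>\<^sub>M lborel) (\<lambda>(x, y). f x * g y * k x y)"
  proof (rule lborel_pair.Fubini_integrable[OF meas])
    show "integrable lborel (\<lambda>x. LINT y|lborel. norm (case (x, y) of (x, y) \<Rightarrow> f x * g y * k x y))"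
    proof (rule Bochner_Integration.integrable_bound)
      show "integrable lborel (\<lambda>x. norm (f x) * (C * (LINT y|lborel. norm (g y))))"
        using f by auto
      show "(\<lambda>x. LINT y|lborel. norm (case (x, y) of (x, y) \<Rightarrow> f x * g y * k x y))
              \<in> borel_measurable lborel"
        using meas by (intro lborel.borel_measurable_lebesgue_integral) (auto simp: case_prod_beta)
      show "AE x in lborel. norm (LINT y|lborel. norm (case (x, y) of (x, y) \<Rightarrow> f x * g y * k x y))
               \<le> norm (norm (f x) * (C * (LINT y|lborel. norm (g y))))"
      proof (rule AE_I2)
        fix x
        have "(LINT y|lborel. norm (f x * g y * k x y)) \<le> (LINT y|lborel. (norm (f x) * C) * norm (g y))"
          by (rule integral_mono) (use inner g le in auto)
        then show "norm (LINT y|lborel. norm (case (x, y) of (x, y) \<Rightarrow> f x * g y * k x y))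
               \<le> norm (norm (f x) * (C * (LINT y|lborel. norm (g y))))"
          using \<open>C \<ge> 0\<close> by (simp add: mult.assoc)
      qed
    qed
  qed (use inner in auto)
qed

text \<open>Differentiation under the integral sign. The parameter may be real or complex.\<close>

lemma has_field_derivative_lebesgue_integral:
  fixes f f' :: "'b::{real_normed_field, banach, second_countable_topology} \<Rightarrow> 'a \<Rightarrow> 'b"
  assumes "r > 0"
    and f: "\<And>y. y \<in> ball x r \<Longrightarrow> integrable M (f y)"
    and deriv: "\<And>y t. y \<in> ball x r \<Longrightarrow> ((\<lambda>y. f y t) has_field_derivative f' y t) (at y)"
    and meas: "f' x \<in> borel_measurable M"
    and bound: "\<And>y t. y \<in> ball x r \<Longrightarrow> norm (f' y t) \<le> g t"
    and g: "integrable M g"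
  shows "((\<lambda>y. LINT t|M. f y t) has_field_derivative (LINT t|M. f' x t)) (at x)"
  unfolding has_field_derivative_iff tendsto_at_iff_sequentially
proof (intro allI impI)
  fix X :: "nat \<Rightarrow> 'b"
  assume X: "\<forall>i. X i \<in> UNIV - {x}" and lim: "X \<longlonglongrightarrow> x"
  have ev: "\<forall>\<^sub>F n in sequentially. X n \<in> ball x r"
    using topological_tendstoD[OF lim open_ball, of x r] \<open>r > 0\<close> by simp
  then obtain N where N: "\<And>n. n \<ge> N \<Longrightarrow> X n \<in> ball x r"
    by (auto simp: eventually_sequentially)
  have x: "x \<in> ball x r" using \<open>r > 0\<close> by simp
  have "(\<lambda>n. LINT t|M. (f (X (n + N)) t - f x t) / (X (n + N) - x)) \<longlonglongrightarrow> (LINT t|M. f' x t)"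
  proof (rule integral_dominated_convergence[where w = g])
    show "(\<lambda>t. (f (X (n + N)) t - f x t) / (X (n + N) - x)) \<in> borel_measurable M" for n
      using f[OF N[of "n + N"]] f[OF x] by (intro borel_measurable_integrable) auto
    show "AE t in M. (\<lambda>n. (f (X (n + N)) t - f x t) / (X (n + N) - x)) \<longlonglongrightarrow> f' x t"
    proof (rule AE_I2)
      fix t
      have "(((\<lambda>y. (f y t - f x t) / (y - x)) \<circ> X) \<longlongrightarrow> f' x t) sequentially"
        using deriv[OF x, of t] X lim
        unfolding has_field_derivative_iff tendsto_at_iff_sequentially by blast
      then show "(\<lambda>n. (f (X (n + N)) t - f x t) / (X (n + N) - x)) \<longlonglongrightarrow> f' x t"
        by (intro LIMSEQ_ignore_initial_segment) (simp add: o_def)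
    qed
    show "AE t in M. norm ((f (X (n + N)) t - f x t) / (X (n + N) - x)) \<le> g t" for n
    proof (rule AE_I2)
      fix t
      have "norm (f (X (n + N)) t - f x t) \<le> g t * norm (X (n + N) - x)"
        using N[of "n + N"] x
        by (intro field_differentiable_bound[of "ball x r" _ "\<lambda>y. f' y t"])
           (auto intro!: bound has_field_derivative_at_within[OF deriv])
      then show "norm ((f (X (n + N)) t - f x t) / (X (n + N) - x)) \<le> g t"
        using X by (simp add: norm_divide divide_le_eq)
    qed
  qed (use meas g in auto)
  moreover have "(LINT t|M. (f (X (n + N)) t - f x t) / (X (n + N) - x)) =
      ((LINT t|M. f (X (n + N)) t) - (LINT t|M. f x t)) / (X (n + N) - x)" for n
    using f[OF N[of "n + N"]] f[OF x]
    by (subst integral_divide_zero) (simp add: Bochner_Integration.integral_diff)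
  ultimately have "(\<lambda>n. ((LINT t|M. f (X (n + N)) t) - (LINT t|M. f x t)) / (X (n + N) - x))
                     \<longlonglongrightarrow> (LINT t|M. f' x t)"
    by (simp only:)
  from LIMSEQ_offset[OF this]
  show "((\<lambda>y. ((LINT t|M. f y t) - (LINT t|M. f x t)) / (y - x)) \<circ> X) \<longlonglongrightarrow> (LINT t|M. f' x t)"
    by (simp add: o_def)
qed

lemma integrable_powr_near_0:
  assumes "p > (-1::real)"
  shows "integrable lborel (\<lambda>x. indicator {0..1} x * x powr p)"
proof -
  have "(\<lambda>x. x powr p) absolutely_integrable_on {0..1}"
    using assms by (intro nonnegative_absolutely_integrable_1 integrable_on_powr_from_0) auto
  then have "integrable lebesgue (\<lambda>x. indicator {0..1} x * x powr p)"
    by (simp add: set_integrable_def)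
  then show ?thesis
    by (subst (asm) integrable_completion) auto
qed

lemma integrable_powr_at_infinity:
  assumes "p < (-1::real)"
  shows "integrable lborel (\<lambda>x. indicator {1..} x * x powr p)"
proof -
  have "(\<lambda>x. x powr p) absolutely_integrable_on {1..}"
    using has_integral_powr_to_inf[of p 1] assms
    by (intro nonnegative_absolutely_integrable_1) (auto simp: integrable_on_def)
  then have "integrable lebesgue (\<lambda>x. indicator {1..} x * x powr p)"
    by (simp add: set_integrable_def)
  then show ?thesis
    by (subst (asm) integrable_completion) auto
qed

text \<open>
  The weight \<open>(1 + \<bar>x\<bar>)\<^sup>-\<^sup>6\<close> is the decay of the Fourier transform of a function with six
  integrable derivatives.
\<close>

lemma integrable_powr_weight:
  assumes "-1 < p" "p < (5::real)"
  shows "integrable lborel (\<lambda>x. \<bar>x\<bar> powr p / (1 + \<bar>x\<bar>) ^ 6)"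
proof -
  define g where "g x = indicator {0..1} x * x powr p + indicator {1..} x * x powr (p - 6)" for x :: real
  have g: "integrable lborel g"
    unfolding g_def using assms
    by (intro Bochner_Integration.integrable_add integrable_powr_near_0 integrable_powr_at_infinity) auto
  have "integrable lborel (\<lambda>x. g x + g (0 + (-1) * x))"
    by (intro Bochner_Integration.integrable_add g lborel_integrable_real_affine) auto
  moreover have nonneg: "g x \<ge> 0" for x by (auto simp: g_def)
  moreover have "\<bar>x\<bar> powr p / (1 + \<bar>x\<bar>) ^ 6 \<le> g \<bar>x\<bar>" for x
  proof (cases "\<bar>x\<bar> \<le> 1")
    case True
    have "\<bar>x\<bar> powr p / (1 + \<bar>x\<bar>) ^ 6 \<le> \<bar>x\<bar> powr p / 1"
      by (intro divide_left_mono) auto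
    then show ?thesis using True by (auto simp: g_def indicator_def)
  next
    case False
    have "\<bar>x\<bar> powr p / (1 + \<bar>x\<bar>) ^ 6 \<le> \<bar>x\<bar> powr p / \<bar>x\<bar> ^ 6"
      using False by (intro divide_left_mono power_mono) auto
    also have "\<dots> = \<bar>x\<bar> powr (p - 6)"
      using False by (simp add: powr_diff)
    finally show ?thesis using False by (auto simp: g_def indicator_def)
  qed
  then have "\<bar>x\<bar> powr p / (1 + \<bar>x\<bar>) ^ 6 \<le> g x + g (-x)" for x
    using nonneg[of x] nonneg[of "-x"] by (smt (verit))
  ultimately show ?thesis
    by (auto intro: Bochner_Integration.integrable_bound[of _ "\<lambda>x. g x + g (-x)"])
qed

section \<open>The Fourier transform\<close>

lemma borel_measurable_cis [measurable]: "cis \<in> borel_measurable borel"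
  by (intro borel_measurable_continuous_onI continuous_intros)

text \<open>
  The Fourier transform, without normalising constant: \<open>fourier f w = \<integral> f x e\<^sup>-\<^sup>i\<^sup>w\<^sup>x dx\<close>.
\<close>

definition fourier :: "(real \<Rightarrow> real) \<Rightarrow> real \<Rightarrow> complex" where
  "fourier f w = (LINT x|lborel. of_real (f x) * cis (- w * x))"

lemma integrable_times_cis:
  assumes "integrable lborel f"
  shows "integrable lborel (\<lambda>x. of_real (f x) * cis (w * x + v))"
  by (rule Bochner_Integration.integrable_bound[OF assms]) (use assms in \<open>auto simp: norm_mult\<close>)

lemma norm_fourier_le:
  "norm (fourier f w) \<le> (LINT x|lborel. \<bar>f x\<bar>)"
proof -
  have "norm (fourier f w) \<le> (LINT x|lborel. norm (of_real (f x) * cis (- w * x)))"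
    unfolding fourier_def by (rule integral_norm_bound)
  then show ?thesis by (simp add: norm_mult)
qed

lemma borel_measurable_fourier [measurable]:
  assumes [measurable]: "f \<in> borel_measurable borel"
  shows "fourier f \<in> borel_measurable borel"
  unfolding fourier_def by measurable

text \<open>
  Differentiation becomes multiplication by \<open>\<i> w\<close>. Integrating the increment
  \<open>F (x + d) - F x\<close> against \<open>cis (- w x)\<close> gives \<open>(cis (w d) - 1) * fourier F w\<close>
  directly, and \<open>(cis (w d) - 1) / (\<i> w) * fourier f w\<close> by Fubini. This avoids both boundary
  terms at infinity and pointwise differentiability of \<open>F\<close>.
\<close>

lemma fourier_derivative:
  assumes "w \<noteq> 0" and F: "integrable lborel F" and f: "integrable lborel f"
    and FTC: "\<And>a b. a \<le> b \<Longrightarrow> F b - F a = set_lebesgue_integral lborel {a..b} f"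
  shows "fourier f w = \<i> * w * fourier F w"
proof -
  \<comment> \<open>a step for which \<open>cis (w * d) - 1\<close> does not vanish\<close>
  define d where "d = pi / \<bar>w\<bar>"
  have "d > 0" using assms(1) by (simp add: d_def)
  have cis_d: "cis (w * d) = -1"
    using assms(1) by (cases "w > 0") (auto simp: d_def simp flip: cis_inverse)
  have [measurable]: "f \<in> borel_measurable borel" using f by auto
  have shift: "integrable lborel (\<lambda>x. f (x + t))" for t
    using lborel_integrable_real_affine[OF f, of 1 t] by (simp add: add.commute)
  have shift_fourier: "(LINT x|lborel. of_real (g (x + t)) * cis (- w * x)) = cis (w * t) * fourier g w" for g t
  proof -
    have "fourier g w = (LINT x|lborel. of_real (g (x + t)) * cis (- w * (x + t)))"
      unfolding fourier_def
      by (subst lborel_integral_real_affine[where c=1 and t=t]) (auto simp: add.commute)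
    then have "cis (w * t) * fourier g w
        = (LINT x|lborel. cis (w * t) * (of_real (g (x + t)) * cis (- w * (x + t))))"
      by simp
    also have "\<dots> = (LINT x|lborel. of_real (g (x + t)) * cis (- w * x))"
    proof (rule Bochner_Integration.integral_cong[OF refl])
      fix x
      have "cis (w * t) * cis (- w * (x + t)) = cis (- w * x)"
        by (simp add: cis_mult algebra_simps)
      then show "cis (w * t) * (of_real (g (x + t)) * cis (- w * (x + t))) = of_real (g (x + t)) * cis (- w * x)"
        by (metis mult.left_commute)
    qed
    finally show ?thesis by simp
  qed
  define k where "k t x = indicator {0..d} t * (of_real (f (x + t)) * cis (- w * x))" for t x
  have k_int: "integrable lborel (\<lambda>x. k t x)" for t
    unfolding k_def using integrable_times_cis[OF shift, of t "-w" 0] by auto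
  have k_meas: "case_prod k \<in> borel_measurable (lborel \<Otimes>\<^sub>M lborel)"
    unfolding k_def by measurable
  have "integrable (lborel \<Otimes>\<^sub>M lborel) (case_prod k)"
  proof (rule lborel_pair.Fubini_integrable[OF k_meas])
    have "(LINT x|lborel. norm (case (t, x) of (t, x) \<Rightarrow> k t x)) = indicator {0..d} t * (LINT x|lborel. \<bar>f x\<bar>)" for t
      using lborel_integral_real_affine[of 1 "\<lambda>x. \<bar>f x\<bar>" t]
      by (simp add: k_def norm_mult add.commute indicator_def)
    moreover have "integrable lborel (indicator {0..d} :: real \<Rightarrow> real)"
      using \<open>d > 0\<close> by (intro integrable_real_indicator) (auto simp: emeasure_lborel_Icc_eq)
    ultimately show "integrable lborel (\<lambda>t. LINT x|lborel. norm (case (t, x) of (t, x) \<Rightarrow> k t x))"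
      by simp
  qed (use k_int in auto)
  from lborel_pair.Fubini_integral[OF this]
  have swap: "(LINT x|lborel. LINT t|lborel. k t x) = (LINT t|lborel. LINT x|lborel. k t x)" .
  have "(LINT t|lborel. k t x) = of_real (F (x + d) - F x) * cis (- w * x)" for x
  proof -
    have "F (x + d) - F x = (LINT t|lborel. indicator {x..x + d} t * f t)"
      using FTC[of x "x + d"] \<open>d > 0\<close> by (simp add: set_lebesgue_integral_def)
    also have "\<dots> = (LINT t|lborel. indicator {0..d} t * f (x + t))"
      by (subst lborel_integral_real_affine[where c=1 and t=x]) (auto simp: indicator_def intro!: Bochner_Integration.integral_cong)
    finally have "of_real (F (x + d) - F x) = (LINT t|lborel. complex_of_real (indicator {0..d} t * f (x + t)))"
      by (simp only: integral_complex_of_real)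
    then have "of_real (F (x + d) - F x) * cis (- w * x) = (LINT t|lborel. complex_of_real (indicator {0..d} t * f (x + t)) * cis (- w * x))"
      by simp
    also have "\<dots> = (LINT t|lborel. k t x)"
      by (intro Bochner_Integration.integral_cong refl) (simp add: k_def indicator_def)
    finally show ?thesis by simp
  qed
  then have "(LINT x|lborel. LINT t|lborel. k t x)
      = (LINT x|lborel. of_real (F (x + d)) * cis (- w * x) - of_real (F x) * cis (- w * x))"
    by (simp add: left_diff_distrib)
  also have "\<dots> = cis (w * d) * fourier F w - fourier F w"
  proof (subst Bochner_Integration.integral_diff)
    show "integrable lborel (\<lambda>x. of_real (F (x + d)) * cis (- w * x))"
      using lborel_integrable_real_affine[OF F, of 1 d] integrable_times_cis[of "\<lambda>x. F (x + d)" "-w" 0]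
      by (simp add: add.commute)
    show "integrable lborel (\<lambda>x. of_real (F x) * cis (- w * x))"
      using integrable_times_cis[OF F, of "-w" 0] by simp
  qed (unfold shift_fourier[of F d], fold fourier_def, rule refl)
  also have "\<dots> = -2 * fourier F w" by (simp add: cis_d)
  finally have lhs: "(LINT x|lborel. LINT t|lborel. k t x) = -2 * fourier F w" .
  have "(LINT t|lborel. indicator {0..d} t *\<^sub>R cis (w * t)) = cis (w * d) / (\<i> * w) - cis (w * 0) / (\<i> * w)"
  proof (rule integral_FTC_Icc)
    show "((\<lambda>t. cis (w * t) / (\<i> * w)) has_vector_derivative cis (w * x)) (at x within {0..d})" for x
      using assms(1) unfolding cis_conv_exp
      by (auto intro!: derivative_eq_intros has_vector_derivative_real_field simp: mult.commute[of _ "\<i>"])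
  qed (use \<open>d > 0\<close> in \<open>auto intro!: continuous_intros\<close>)
  then have int_cis: "(LINT t|lborel. indicator {0..d} t * cis (w * t)) = -2 / (\<i> * w)"
    by (simp add: cis_d scaleR_conv_of_real of_real_indicator diff_divide_distrib[symmetric] del: of_real_mult)
  have "(LINT x|lborel. k t x) = (indicator {0..d} t * cis (w * t)) * fourier f w" for t
    unfolding k_def using shift_fourier[of f t] by simp
  then have "(LINT t|lborel. LINT x|lborel. k t x) = (-2 / (\<i> * w)) * fourier f w"
    by (simp only: integral_mult_left_zero int_cis)
  with swap lhs have "-2 * fourier F w = (-2 / (\<i> * w)) * fourier f w" by (simp only:)
  then show ?thesis using assms(1) by (simp add: field_simps)
qed

lemma gaussian_integral_cis:
  assumes "n > 0"
  shows "(LINT w|lborel. of_real (exp (- (w / n)\<^sup>2 / 2)) * cis (w * v)) =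
         of_real (n * sqrt (2 * pi) * exp (- (n * v)\<^sup>2 / 2))"
proof -
  have "complex_of_real (exp (- ((n * v)\<^sup>2) / 2)) = char std_normal_distribution (n * v)"
    by (simp add: char_std_normal_distribution)
  also have "\<dots> = (LINT s|lborel. std_normal_density s *\<^sub>R cis (n * v * s))"
    unfolding char_def cis_conv_exp
    by (subst integral_density) (auto simp: normal_density_nonneg)
  also have "\<dots> = (LINT s|lborel. of_real (1 / sqrt (2 * pi)) * (of_real (exp (- s\<^sup>2 / 2)) * cis (n * v * s)))"
    by (simp add: std_normal_density_def scaleR_conv_of_real mult_ac)
  also have "\<dots> = of_real (1 / sqrt (2 * pi)) * (LINT s|lborel. of_real (exp (- s\<^sup>2 / 2)) * cis (n * v * s))"
    by (rule integral_mult_right_zero)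
  finally have "(LINT s|lborel. of_real (exp (- s\<^sup>2 / 2)) * cis (n * v * s)) = of_real (sqrt (2 * pi) * exp (- ((n * v)\<^sup>2) / 2))"
    by (simp add: field_simps del: of_real_exp flip: of_real_mult)
  moreover have "(LINT w|lborel. of_real (exp (- (w / n)\<^sup>2 / 2)) * cis (w * v))
      = of_real n * (LINT s|lborel. of_real (exp (- s\<^sup>2 / 2)) * cis (n * v * s))"
    using assms
    by (subst lborel_integral_real_affine[where c=n and t=0]) (auto simp: scaleR_conv_of_real mult_ac)
  ultimately show ?thesis by simp
qed

lemma integrable_gaussian:
  assumes "n > 0"
  shows "integrable lborel (\<lambda>w. exp (- (w / n)\<^sup>2 / 2) :: real)"
proof -
  have "integrable lborel (\<lambda>s. sqrt (2 * pi) * std_normal_density s)"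
    by (intro integrable_mult_right integrable_normal_density) auto
  then have "integrable lborel (\<lambda>s. exp (- s\<^sup>2 / 2) :: real)"
    by (simp add: std_normal_density_def)
  from lborel_integrable_real_affine[OF this, of "1 / n" 0] show ?thesis
    using assms by simp
qed

text \<open>
  Fourier inversion by Gaussian regularisation: the damped inverse transform is the average of
  \<open>u (x + s / n)\<close> over a standard normal \<open>s\<close>, up to the factor \<open>2 \<pi>\<close>.
\<close>

lemma fourier_inversion:
  assumes u: "integrable lborel u" and cont: "continuous_on UNIV u"
    and bounded: "\<And>x. \<bar>u x\<bar> \<le> B"
    and hat: "integrable lborel (fourier u)"
  shows "of_real (u x) = 1 / (2 * pi) * (LINT w|lborel. fourier u w * cis (w * x))"
proof -
  define G where "G n w = exp (- (w / real (Suc n))\<^sup>2 / 2)" for n w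
  define S where "S n = (LINT w|lborel. fourier u w * (G n w * cis (w * x)))" for n
  have G_meas [measurable]: "G n \<in> borel_measurable borel" for n
    unfolding G_def by measurable
  have u_meas [measurable]: "u \<in> borel_measurable borel" using u by auto
  have G_int: "integrable lborel (G n)" for n
    unfolding G_def by (rule integrable_gaussian) auto
  have G_le: "G n w \<ge> 0" "G n w \<le> 1" for n w by (auto simp: G_def)
  have "S \<longlonglongrightarrow> (LINT w|lborel. fourier u w * cis (w * x))"
    unfolding S_def
  proof (rule integral_dominated_convergence[where w = "\<lambda>w. norm (fourier u w)"])
    show "AE w in lborel. (\<lambda>n. fourier u w * (G n w * cis (w * x))) \<longlonglongrightarrow> fourier u w * cis (w * x)"
    proof (rule AE_I2)
      fix w :: real
      have "(\<lambda>n. w / real (Suc n)) \<longlonglongrightarrow> 0"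
        by (intro LIMSEQ_Suc lim_const_over_n)
      then have "(\<lambda>n. G n w) \<longlonglongrightarrow> exp (- 0\<^sup>2 / 2)"
        unfolding G_def by (intro tendsto_intros) auto
      then have "(\<lambda>n. complex_of_real (G n w)) \<longlonglongrightarrow> 1"
        using tendsto_of_real[of "\<lambda>n. G n w" 1 sequentially] by simp
      then have "(\<lambda>n. fourier u w * (G n w * cis (w * x))) \<longlonglongrightarrow> fourier u w * (1 * cis (w * x))"
        by (intro tendsto_intros)
      then show "(\<lambda>n. fourier u w * (G n w * cis (w * x))) \<longlonglongrightarrow> fourier u w * cis (w * x)" by simp
    qed
    show "AE w in lborel. norm (fourier u w * (G n w * cis (w * x))) \<le> norm (fourier u w)" for n
      using G_le[of n] by (auto simp: norm_mult mult_left_le)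
  qed (use hat in auto)
  moreover have "S \<longlonglongrightarrow> 2 * pi * of_real (u x)"
  proof -
    have S_eq: "S n = of_real (2 * pi * (LINT s|lborel. std_normal_density s * u (x + s / real (Suc n))))" for n
    proof -
      let ?n = "real (Suc n)"
      have "S n = (LINT w|lborel. LINT y|lborel. of_real (u y) * of_real (G n w) * cis (w * (x - y)))"
        unfolding S_def fourier_def
      proof (rule Bochner_Integration.integral_cong[OF refl])
        fix w
        have "(LINT y|lborel. of_real (u y) * cis (- w * y)) * (G n w * cis (w * x))
          = (LINT y|lborel. of_real (u y) * cis (- w * y) * (G n w * cis (w * x)))"
          by simp
        also have "\<dots> = (LINT y|lborel. of_real (u y) * of_real (G n w) * cis (w * (x - y)))"
        proof (rule Bochner_Integration.integral_cong[OF refl])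
          fix y
          have "cis (w * (x - y)) = cis (- w * y) * cis (w * x)"
            by (simp add: cis_mult algebra_simps)
          then show "of_real (u y) * cis (- w * y) * (G n w * cis (w * x)) = of_real (u y) * of_real (G n w) * cis (w * (x - y))"
            by simp
        qed
        finally show "(LINT y|lborel. of_real (u y) * cis (- w * y)) * (G n w * cis (w * x)) =
           (LINT y|lborel. of_real (u y) * of_real (G n w) * cis (w * (x - y)))" .
      qed
      also have "\<dots> = (LINT y|lborel. LINT w|lborel. of_real (u y) * of_real (G n w) * cis (w * (x - y)))"
        by (rule lborel_fubini_bounded_kernel[where C = 1]) (use u G_int in auto)
      also have "\<dots> = (LINT y|lborel. of_real (u y * (?n * sqrt (2 * pi) * exp (- (?n * (x - y))\<^sup>2 / 2))))"
      proof (rule Bochner_Integration.integral_cong[OF refl])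
        fix y
        have "(LINT w|lborel. of_real (u y) * of_real (G n w) * cis (w * (x - y)))
           = of_real (u y) * (LINT w|lborel. of_real (exp (- (w / ?n)\<^sup>2 / 2)) * cis (w * (x - y)))"
          unfolding G_def mult.assoc by (simp del: of_nat_Suc)
        then show "(LINT w|lborel. of_real (u y) * of_real (G n w) * cis (w * (x - y)))
           = of_real (u y * (?n * sqrt (2 * pi) * exp (- (?n * (x - y))\<^sup>2 / 2)))"
          by (subst (asm) gaussian_integral_cis) auto
      qed
      also have "\<dots> = of_real (LINT y|lborel. u y * (?n * sqrt (2 * pi) * exp (- (?n * (x - y))\<^sup>2 / 2)))"
        by (rule integral_complex_of_real)
      also have "(LINT y|lborel. u y * (?n * sqrt (2 * pi) * exp (- (?n * (x - y))\<^sup>2 / 2)))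
          = \<bar>1 / ?n\<bar> *\<^sub>R (LINT s|lborel. u (x + (1 / ?n) * s) * (?n * sqrt (2 * pi) * exp (- (?n * (x - (x + (1 / ?n) * s)))\<^sup>2 / 2)))"
        by (rule lborel_integral_real_affine) simp
      also have "\<dots> = (LINT s|lborel. 2 * pi * (std_normal_density s * u (x + s / ?n)))"
        unfolding real_scaleR_def integral_mult_right_zero[symmetric]
      proof (rule Bochner_Integration.integral_cong[OF refl])
        fix s
        have "?n * (x - (x + 1 / ?n * s)) = - s" by (simp add: field_simps)
        moreover have "2 * pi * (1 / sqrt (2 * pi) * exp (- s\<^sup>2 / 2) * u (x + s / ?n)) =
            sqrt (2 * pi) * exp (- s\<^sup>2 / 2) * u (x + s / ?n)"
          using real_sqrt_mult_self[of "2 * pi"] by (simp add: field_simps del: of_nat_Suc)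
        ultimately show "\<bar>1 / ?n\<bar> * (u (x + 1 / ?n * s) * (?n * sqrt (2 * pi) * exp (- (?n * (x - (x + 1 / ?n * s)))\<^sup>2 / 2))) =
          2 * pi * (std_normal_density s * u (x + s / ?n))"
          unfolding std_normal_density_def by (simp del: of_nat_Suc)
      qed
      finally show ?thesis by simp
    qed
    have "(\<lambda>n. LINT s|lborel. std_normal_density s * u (x + s / real (Suc n)))
            \<longlonglongrightarrow> (LINT s|lborel. std_normal_density s * u x)"
    proof (rule integral_dominated_convergence[where w = "\<lambda>s. std_normal_density s * B"])
      show "AE s in lborel. (\<lambda>n. std_normal_density s * u (x + s / real (Suc n))) \<longlonglongrightarrow> std_normal_density s * u x"
      proof (rule AE_I2)
        fix s :: real
        have "(\<lambda>n. x + s / real (Suc n)) \<longlonglongrightarrow> x + 0"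
          by (intro tendsto_intros LIMSEQ_Suc lim_const_over_n)
        then have "(\<lambda>n. u (x + s / real (Suc n))) \<longlonglongrightarrow> u x"
          using cont by (intro isCont_tendsto_compose[of x u]) (auto simp: continuous_on_eq_continuous_at)
        then show "(\<lambda>n. std_normal_density s * u (x + s / real (Suc n))) \<longlonglongrightarrow> std_normal_density s * u x"
          by (intro tendsto_intros)
      qed
      show "AE s in lborel. norm (std_normal_density s * u (x + s / real (Suc n))) \<le> std_normal_density s * B" for n
        using bounded by (auto simp: abs_mult intro!: mult_left_mono)
    qed auto
    then have "(\<lambda>n. LINT s|lborel. std_normal_density s * u (x + s / real (Suc n))) \<longlonglongrightarrow> u x"
      by simp
    then have "(\<lambda>n. complex_of_real (2 * pi * (LINT s|lborel. std_normal_density s * u (x + s / real (Suc n)))))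
        \<longlonglongrightarrow> of_real (2 * pi * u x)"
      by (intro tendsto_intros)
    then show ?thesis by (simp add: S_eq[abs_def] del: of_nat_Suc)
  qed
  ultimately have "(LINT w|lborel. fourier u w * cis (w * x)) = 2 * pi * of_real (u x)"
    by (rule LIMSEQ_unique)
  then show ?thesis by simp
qed

lemma derivs_in_L1_fourier_decay:
  assumes "derivs_in_L1 6 u"
  obtains M where "\<And>w. norm (fourier u w) \<le> M / (1 + \<bar>w\<bar>) ^ 6"
proof -
  obtain D :: "nat \<Rightarrow> real \<Rightarrow> real" where D: "D 0 = u" "\<And>j. j \<le> 6 \<Longrightarrow> integrable lborel (D j)"
    "\<And>j a b. j < 6 \<Longrightarrow> a \<le> b \<Longrightarrow> D j b - D j a = set_lebesgue_integral lborel {a..b} (D (Suc j))"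
    using assms unfolding derivs_in_L1_def by blast
  define N where "N j = (LINT x|lborel. \<bar>D j x\<bar>)" for j
  have N: "N j \<ge> 0" for j by (simp add: N_def)
  have pow: "fourier (D j) w = (\<i> * w) ^ j * fourier u w" if "w \<noteq> 0" "j \<le> 6" for j w
    using that(2)
  proof (induction j)
    case (Suc j)
    then have "fourier (D (Suc j)) w = \<i> * w * fourier (D j) w"
      using D \<open>w \<noteq> 0\<close> by (intro fourier_derivative) auto
    then show ?case using Suc by simp
  qed (simp add: D)
  have "norm (fourier u w) \<le> 64 * (N 0 + N 6) / (1 + \<bar>w\<bar>) ^ 6" for w
  proof -
    have 0: "norm (fourier u w) \<le> N 0"
      using norm_fourier_le[of "D 0" w] by (simp add: N_def D)
    have 6: "\<bar>w\<bar> ^ 6 * norm (fourier u w) \<le> N 6"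
    proof (cases "w = 0")
      case False
      then show ?thesis
        using norm_fourier_le[of "D 6" w] pow[of w 6] by (simp add: N_def norm_mult norm_power)
    qed (use N in auto)
    have "(1 + \<bar>w\<bar>) ^ 6 \<le> 64 * (1 + \<bar>w\<bar> ^ 6)"
    proof -
      have "(1 + \<bar>w\<bar>) ^ 6 \<le> (2 * max 1 \<bar>w\<bar>) ^ 6" by (intro power_mono) auto
      also have "\<dots> = 64 * max 1 \<bar>w\<bar> ^ 6" by (simp add: power_mult_distrib)
      also have "max 1 \<bar>w\<bar> ^ 6 \<le> 1 + \<bar>w\<bar> ^ 6" by (simp add: max_def)
      finally show ?thesis by simp
    qed
    then have "(1 + \<bar>w\<bar>) ^ 6 * norm (fourier u w) \<le> 64 * (1 + \<bar>w\<bar> ^ 6) * norm (fourier u w)"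
      by (intro mult_right_mono) auto
    also have "\<dots> \<le> 64 * (N 0 + N 6)" using 0 6 by (simp add: algebra_simps)
    finally show ?thesis by (simp add: field_simps add_pos_nonneg)
  qed
  then show ?thesis by (rule that)
qed

lemma derivs_in_L1_bounded_continuous:
  assumes "derivs_in_L1 (Suc m) u"
  shows "continuous_on UNIV u" "\<exists>B. \<forall>x. \<bar>u x\<bar> \<le> B" "integrable lborel u"
proof -
  obtain D :: "nat \<Rightarrow> real \<Rightarrow> real" where D: "D 0 = u" "integrable lborel (D 0)" "integrable lborel (D 1)"
    and FTC: "\<And>a b. a \<le> b \<Longrightarrow> u b - u a = set_lebesgue_integral lborel {a..b} (D 1)"
    using assms unfolding derivs_in_L1_def by force
  show "integrable lborel u" using D by simp
  have bound: "\<bar>u b - u a\<bar> \<le> (LINT x|lborel. \<bar>D 1 x\<bar>)" if "a \<le> b" for a b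
  proof -
    have "norm (LINT x|lborel. indicator {a..b} x *\<^sub>R D 1 x) \<le> (LINT x|lborel. norm (indicator {a..b} x *\<^sub>R D 1 x))"
      by (rule integral_norm_bound)
    also have "\<dots> \<le> (LINT x|lborel. \<bar>D 1 x\<bar>)"
      using D(3) by (intro integral_mono integrable_norm integrable_mult_indicator integrable_abs)
        (auto simp: indicator_def)
    finally have "\<bar>LINT x|lborel. indicator {a..b} x *\<^sub>R D 1 x\<bar> \<le> (LINT x|lborel. \<bar>D 1 x\<bar>)"
      by simp
    then show ?thesis using FTC[OF that] by (simp add: set_lebesgue_integral_def)
  qed
  have "\<bar>u x\<bar> \<le> \<bar>u 0\<bar> + (LINT x|lborel. \<bar>D 1 x\<bar>)" for x
    using bound[of 0 x] bound[of x 0] by linarith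
  then show "\<exists>B. \<forall>x. \<bar>u x\<bar> \<le> B" by blast
  show "continuous_on UNIV u"
  proof -
    have "continuous_on {-K..K} u" for K
    proof -
      have "set_integrable lborel {-K..K} (D 1)"
        using D unfolding set_integrable_def by (intro integrable_mult_indicator) auto
      then have "D 1 absolutely_integrable_on {-K..K}"
        unfolding set_integrable_def by (subst integrable_completion) auto
      then have int: "D 1 integrable_on {-K..K}" by (rule set_lebesgue_integral_eq_integral)
      have eq: "u (-K) + integral {-K..x} (D 1) = u x" if "x \<in> {-K..K}" for x
      proof -
        have "set_integrable lborel {-K..x} (D 1)"
          using D unfolding set_integrable_def by (intro integrable_mult_indicator) auto
        then have "set_lebesgue_integral lborel {-K..x} (D 1) = integral {-K..x} (D 1)"
          by (rule set_borel_integral_eq_integral)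
        then show ?thesis using FTC[of "-K" x] that by simp
      qed
      have "continuous_on {-K..K} (\<lambda>x. u (-K) + integral {-K..x} (D 1))"
        by (intro continuous_intros indefinite_integral_continuous_1 int)
      then show ?thesis by (rule continuous_on_eq) (use eq in auto)
    qed
    then have "isCont u x" for x
      by (rule continuous_on_interior[of "{-(\<bar>x\<bar> + 1)..\<bar>x\<bar> + 1}" u x]) auto
    then show ?thesis by (simp add: continuous_at_imp_continuous_on)
  qed
qed

section \<open>The Laplace transform of a power\<close>

lemma integrable_powr_exp:
  assumes "p > (-1::real)" "a > 0"
  shows "integrable lborel (\<lambda>t. indicator {0..} t * (t powr p * exp (- a * t)) :: real)"
proof -
  have int: "(\<lambda>t. norm (complex_of_real t powr (of_real (p + 1) - 1) / of_real (exp (a * t)))) absolutely_integrable_on {0<..}"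
    using absolutely_integrable_Gamma_integral[of "of_real (p + 1)" a] assms
    by (intro set_integrable_norm) auto
  have eq: "norm (complex_of_real t powr (of_real (p + 1) - 1) / of_real (exp (a * t))) = t powr p * exp (- a * t)"
    if "t \<in> {0<..}" for t
    using that by (simp add: norm_divide norm_powr_real_powr exp_minus divide_simps)
  have "(\<lambda>t. indicator {0<..} t *\<^sub>R norm (complex_of_real t powr (of_real (p + 1) - 1) / of_real (exp (a * t))))
      = (\<lambda>t. indicator {0<..} t *\<^sub>R (t powr p * exp (- a * t)))"
    using eq by (auto simp: fun_eq_iff indicator_def simp del: of_real_add)
  with int have "integrable lebesgue (\<lambda>t. indicator {0<..} t *\<^sub>R (t powr p * exp (- a * t)))"
    unfolding set_integrable_def by (simp only:)
  moreover have "(\<lambda>t. indicator {0<..} t *\<^sub>R (t powr p * exp (- a * t)))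
      = (\<lambda>t. indicator {0..} t * (t powr p * exp (- a * t)))"
    by (auto simp: fun_eq_iff indicator_def)
  ultimately show ?thesis
    by (subst (asm) integrable_completion) auto
qed

lemma laplace_powr_real:
  assumes "p > (-1::real)" "a > 0"
  shows "(LINT t|lborel. indicator {0..} t * (t powr p * exp (- a * t)) :: real) = Gamma (p + 1) * a powr (- (p + 1))"
proof -
  let ?g = "\<lambda>t::real. indicator {0..} t * (t powr p * exp (- 1 * t)) :: real"
  have "set_integrable lborel {0..} (\<lambda>t. t powr p * exp (- 1 * t))"
    using integrable_powr_exp[of p 1] assms by (simp add: set_integrable_def)
  then have "(LINT t|lborel. ?g t) = integral {0..} (\<lambda>t. t powr p * exp (- 1 * t))"
    by (subst set_borel_integral_eq_integral(2)[symmetric]) (auto simp: set_lebesgue_integral_def)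
  also have "\<dots> = Gamma (p + 1)"
    using Gamma_integral_real[of "p + 1"] assms
    by (intro integral_unique) (simp add: exp_minus divide_inverse)
  finally have "Gamma (p + 1) = \<bar>a\<bar> *\<^sub>R (LINT t|lborel. ?g (0 + a * t))"
    using assms by (subst lborel_integral_real_affine[where c=a and t=0, symmetric]) auto
  also have "(LINT t|lborel. ?g (0 + a * t)) = (LINT t|lborel. a powr p * (indicator {0..} t * (t powr p * exp (- a * t))))"
    using assms by (intro Bochner_Integration.integral_cong refl) (auto simp: indicator_def powr_mult zero_le_mult_iff)
  also have "\<dots> = a powr p * (LINT t|lborel. indicator {0..} t * (t powr p * exp (- a * t)))"
    by (rule integral_mult_right_zero)
  finally have "Gamma (p + 1) = a powr (p + 1) * (LINT t|lborel. indicator {0..} t * (t powr p * exp (- a * t)))"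
    using assms by (simp add: powr_add mult_ac)
  then have "Gamma (p + 1) * a powr (- (p + 1)) = (a powr (p + 1) * a powr (- (p + 1))) *
      (LINT t|lborel. indicator {0..} t * (t powr p * exp (- a * t)))"
    by (simp only: mult_ac)
  also have "a powr (p + 1) * a powr (- (p + 1)) = 1"
    using assms by (simp only: powr_minus) simp
  finally show ?thesis by simp
qed

text \<open>
  Both sides are holomorphic in the right half plane and agree on the positive reals.
\<close>

lemma laplace_powr:
  fixes z :: complex
  assumes "p > (-1::real)" "Re z > 0"
  shows "(LINT t|lborel. of_real (indicator {0..} t * t powr p) * exp (- z * of_real t))
         = of_real (Gamma (p + 1)) * z powr (- of_real (p + 1))"
proof -
  define f where "f z t = of_real (indicator {0..} t * t powr p) * exp (- z * of_real t)" for z :: complex and t :: real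
  define S where "S = {z :: complex. Re z > 0}"
  have norm_f: "norm (f z t) = indicator {0..} t * (t powr p * exp (- Re z * t))" for z t
    by (auto simp: f_def norm_mult indicator_def)
  have meas [measurable]: "f z \<in> borel_measurable borel" for z
    unfolding f_def by measurable
  have int: "integrable lborel (f z)" if "Re z > 0" for z
    using integrable_powr_exp[OF assms(1) that] by (subst integrable_norm_iff[symmetric]) (auto simp: norm_f)
  have "(\<lambda>z. LINT t|lborel. f z t) holomorphic_on S"
  proof -
    have "((\<lambda>z. LINT t|lborel. f z t) has_field_derivative (LINT t|lborel. - of_real t * f z t)) (at z)"
      if "z \<in> S" for z
    proof (rule has_field_derivative_lebesgue_integral[where r = "Re z / 2" and
        g = "\<lambda>t. indicator {0..} t * (t powr (p + 1) * exp (- (Re z / 2) * t))"])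
      have Re_pos: "Re y \<ge> Re z / 2" if "y \<in> ball z (Re z / 2)" for y
        using abs_Re_le_cmod[of "z - y"] that by (auto simp: dist_norm)
      then show "integrable lborel (f y)" if "y \<in> ball z (Re z / 2)" for y
        using \<open>z \<in> S\<close> that by (intro int) (force simp: S_def)
      show "((\<lambda>y. f y t) has_field_derivative - of_real t * f y t) (at y)" for y t
        unfolding f_def by (auto intro!: derivative_eq_intros)
      show "norm (- of_real t * f y t) \<le> indicator {0..} t * (t powr (p + 1) * exp (- (Re z / 2) * t))"
        if "y \<in> ball z (Re z / 2)" for y t
      proof (cases "t > 0")
        case True
        have "Re z / 2 * t \<le> Re y * t"
          using Re_pos[OF that] True by (intro mult_right_mono) auto
        then have "t powr p * t * exp (- Re y * t) \<le> t powr p * t * exp (- (Re z / 2) * t)"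
          using True by (intro mult_left_mono) auto
        then show ?thesis using True unfolding norm_mult norm_f by (simp add: powr_add mult_ac)
      qed (auto simp: norm_mult norm_f indicator_def)
      show "integrable lborel (\<lambda>t. indicator {0..} t * (t powr (p + 1) * exp (- (Re z / 2) * t)))"
        using that assms by (intro integrable_powr_exp) (auto simp: S_def)
    qed (use that in \<open>auto simp: S_def\<close>)
    then show ?thesis by (auto simp: holomorphic_on_def field_differentiable_def intro: has_field_derivative_at_within)
  qed
  moreover have "(\<lambda>z. of_real (Gamma (p + 1)) * z powr (- of_real (p + 1))) holomorphic_on S"
    by (auto intro!: holomorphic_intros simp: S_def complex_nonpos_Reals_iff)
  ultimately have hol: "(\<lambda>z. (LINT t|lborel. f z t) - of_real (Gamma (p + 1)) * z powr (- of_real (p + 1))) holomorphic_on S"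
    by (rule holomorphic_on_diff)
  have "(LINT t|lborel. f z t) - of_real (Gamma (p + 1)) * z powr (- of_real (p + 1)) = 0"
  proof (rule analytic_continuation[OF hol, where U = "of_real ` {0<..}" and \<xi> = 1])
    show "open S" unfolding S_def by (rule open_halfspace_Re_gt)
    show "connected S" unfolding S_def by (intro convex_connected convex_halfspace_Re_gt)
    show "(1::complex) islimpt of_real ` {0<..}"
      unfolding islimpt_approachable
    proof (intro allI impI)
      fix e :: real assume "e > 0"
      then show "\<exists>x'\<in>complex_of_real ` {0<..}. x' \<noteq> 1 \<and> dist x' 1 < e"
        by (intro bexI[of _ "of_real (1 + e / 2)"] imageI) (auto simp: dist_norm norm_divide)
    qed
  next
    fix w :: complex assume "w \<in> of_real ` {0<..}"
    then obtain a where a: "w = of_real a" "a > 0" by auto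
    have "f w t = of_real (indicator {0..} t * (t powr p * exp (- a * t)))" for t
      by (simp add: f_def a exp_of_real[symmetric])
    then have "(LINT t|lborel. f w t) = of_real (LINT t|lborel. indicator {0..} t * (t powr p * exp (- a * t)))"
      by (simp only: integral_complex_of_real)
    also have "\<dots> = of_real (Gamma (p + 1) * a powr (- (p + 1)))"
      using assms a by (simp only: laplace_powr_real)
    also have "\<dots> = of_real (Gamma (p + 1)) * w powr (- of_real (p + 1))"
      using a powr_of_real[of a "- (p + 1)"] by simp
    finally show "(LINT t|lborel. f w t) - of_real (Gamma (p + 1)) * w powr (- of_real (p + 1)) = 0"
      by simp
  qed (use assms in \<open>auto simp: S_def\<close>)
  then show ?thesis by (simp add: f_def)
qed

section \<open>Functions with a decaying Fourier density\<close>

lemma has_real_derivative_Re_fourier: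
  fixes \<psi> :: "real \<Rightarrow> complex"
  assumes \<psi>: "integrable lborel \<psi>" and w\<psi>: "integrable lborel (\<lambda>w. \<i> * w * \<psi> w)"
  shows "((\<lambda>y. Re (LINT w|lborel. \<psi> w * cis (w * y))) has_real_derivative
          Re (LINT w|lborel. (\<i> * w * \<psi> w) * cis (w * y))) (at y)"
proof -
  have int: "integrable lborel (\<lambda>w. f w * cis (w * y))" if "integrable lborel f" for f y
    by (rule Bochner_Integration.integrable_bound[OF that]) (use that in \<open>auto simp: norm_mult\<close>)
  have "((\<lambda>y. LINT w|lborel. Re (\<psi> w * cis (w * y))) has_real_derivative
          (LINT w|lborel. Re ((\<i> * w * \<psi> w) * cis (w * y)))) (at y)"
  proof (rule has_field_derivative_lebesgue_integral[where r = 1 and g = "\<lambda>w. norm (\<i> * w * \<psi> w)"])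
    show "integrable lborel (\<lambda>w. Re (\<psi> w * cis (w * y)))" for y
      by (intro integrable_Re int \<psi>)
    show "((\<lambda>y. Re (\<psi> w * cis (w * y))) has_real_derivative Re ((\<i> * w * \<psi> w) * cis (w * y))) (at y)" for w y
      by (auto intro!: derivative_eq_intros simp: algebra_simps)
    show "(\<lambda>w. Re (\<i> * w * \<psi> w * cis (w * y))) \<in> borel_measurable lborel"
      by (rule borel_measurable_integrable[OF integrable_Re[OF int[OF w\<psi>]]])
    show "norm (Re (\<i> * w * \<psi> w * cis (w * y))) \<le> norm (\<i> * w * \<psi> w)" for w y
      using abs_Re_le_cmod[of "\<i> * w * \<psi> w * cis (w * y)"] by (simp add: norm_mult)
  qed (use w\<psi> in auto)
  then show ?thesis
    by (simp only: integral_Re[OF int[OF \<psi>]] integral_Re[OF int[OF w\<psi>]])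
qed

lemma measurable_imaginary_powr [measurable]: "(\<lambda>w::real. (\<i> * of_real w) powr of_real a) \<in> borel_measurable borel"
proof (rule borel_measurable_continuous_countable_exceptions[of "{0}"])
  show "continuous_on (- {0}) (\<lambda>w::real. (\<i> * of_real w) powr of_real a)"
    by (intro continuous_on_powr_complex continuous_intros) auto
qed auto

lemma norm_imaginary_powr: "norm ((\<i> * of_real w) powr of_real a) = \<bar>w\<bar> powr a"
  by (simp add: norm_powr_real_powr' norm_mult)

text \<open>
  An integrable function \<open>u\<close> which is the inverse Fourier transform of a density \<open>\<phi>\<close> (the
  factor \<open>1 / (2 \<pi>)\<close> is absorbed in \<open>\<phi>\<close>) that decays like \<open>\<bar>w\<bar>\<^sup>-\<^sup>6\<close>.
\<close>

locale fourier_representation =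
  fixes u :: "real \<Rightarrow> real" and \<phi> :: "real \<Rightarrow> complex" and M :: real
  assumes u_integrable: "integrable lborel u"
    and density_measurable [measurable]: "\<phi> \<in> borel_measurable borel"
    and density_decay: "\<And>w. norm (\<phi> w) \<le> M / (1 + \<bar>w\<bar>) ^ 6"
    and representation: "\<And>x. of_real (u x) = (LINT w|lborel. \<phi> w * cis (w * x))"
begin

lemma u_measurable [measurable]: "u \<in> borel_measurable borel"
  using u_integrable by auto

lemma M_nonneg: "M \<ge> 0"
  using order_trans[OF norm_ge_zero density_decay[of 0]] by simp

text \<open>
  Multipliers need only be bounded by a power of \<open>\<bar>w\<bar>\<close> away from the origin, which is a null
  set; this covers the singular multiplier \<open>(\<i> w) powr (- g)\<close>.
\<close>

lemma integrable_density_times: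
  assumes [measurable]: "m \<in> borel_measurable borel" and "-1 < p" "p < 5"
    and bound: "\<And>w. w \<noteq> 0 \<Longrightarrow> norm (m w) \<le> C * \<bar>w\<bar> powr p"
  shows "integrable lborel (\<lambda>w. \<phi> w * m w)"
proof (rule Bochner_Integration.integrable_bound)
  show "integrable lborel (\<lambda>w. M * C * (\<bar>w\<bar> powr p / (1 + \<bar>w\<bar>) ^ 6))"
    using assms by (intro integrable_mult_right integrable_powr_weight)
  show "AE w in lborel. norm (\<phi> w * m w) \<le> norm (M * C * (\<bar>w\<bar> powr p / (1 + \<bar>w\<bar>) ^ 6))"
    using AE_lborel_singleton[of "0::real"]
  proof eventually_elim
    case (elim w)
    have "norm (\<phi> w * m w) \<le> (M / (1 + \<bar>w\<bar>) ^ 6) * (C * \<bar>w\<bar> powr p)"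
      unfolding norm_mult using elim M_nonneg by (intro mult_mono density_decay bound) auto
    then have "norm (\<phi> w * m w) \<le> M * C * (\<bar>w\<bar> powr p / (1 + \<bar>w\<bar>) ^ 6)"
      by (simp add: mult_ac)
    then show ?case unfolding real_norm_def by (rule order_trans[OF _ abs_ge_self])
  qed
qed simp

lemma integrable_density: "integrable lborel \<phi>"
  using integrable_density_times[of "\<lambda>_. 1" 0 1] by simp

lemma integrable_density_cis: "integrable lborel (\<lambda>w. \<phi> w * cis (w * x))"
  using integrable_density_times[of "\<lambda>w. cis (w * x)" 0 1] by simp

lemma u_bounded: "\<bar>u x\<bar> \<le> (LINT w|lborel. norm (\<phi> w))"
proof -
  have "norm (of_real (u x) :: complex) \<le> (LINT w|lborel. norm (\<phi> w * cis (w * x)))"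
    unfolding representation by (rule integral_norm_bound)
  then show ?thesis by (simp add: norm_mult)
qed

lemma integrable_frac_integrand:
  assumes "0 < g" "g < 1"
  shows "integrable lborel (\<lambda>t. indicator {0..} t * t powr (g - 1) * u (y - t))"
proof (rule Bochner_Integration.integrable_bound)
  let ?B = "LINT w|lborel. norm (\<phi> w)"
  show "integrable lborel (\<lambda>t. ?B * (indicator {0..1} t * t powr (g - 1)) + \<bar>u (y + (-1) * t)\<bar>)"
    using assms u_integrable
    by (intro Bochner_Integration.integrable_add integrable_mult_right integrable_powr_near_0 integrable_abs
          lborel_integrable_real_affine) auto
  have "?B \<ge> 0" by simp
  have "norm (indicator {0..} t * t powr (g - 1) * u (y - t)) \<le>
          ?B * (indicator {0..1} t * t powr (g - 1)) + \<bar>u (y + (-1) * t)\<bar>" for t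
  proof (cases "0 \<le> t \<and> t \<le> 1")
    case True
    then have "t powr (g - 1) * \<bar>u (y - t)\<bar> \<le> t powr (g - 1) * ?B"
      by (intro mult_left_mono u_bounded) auto
    moreover have "0 \<le> \<bar>u (y - t)\<bar>" by simp
    ultimately show ?thesis using True by (simp add: abs_mult mult_ac)
  next
    case False
    then show ?thesis
    proof (cases "t > 1")
      case True
      have "t powr (g - 1) \<le> t powr 0" using True assms by (intro powr_mono) auto
      then have "t powr (g - 1) * \<bar>u (y - t)\<bar> \<le> 1 * \<bar>u (y - t)\<bar>"
        using True by (intro mult_right_mono) auto
      then show ?thesis using True by (simp add: abs_mult)
    qed auto
  qed
  then show "AE t in lborel. norm (indicator {0..} t * t powr (g - 1) * u (y - t)) \<le>
          norm (?B * (indicator {0..1} t * t powr (g - 1)) + \<bar>u (y + (-1) * t)\<bar>)"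
    by (intro AE_I2) (smt (verit) real_norm_def)
qed simp

text \<open>
  The fractional integral of order \<open>g\<close> has the multiplier \<open>(\<i> w) powr (- g)\<close>. The kernel
  \<open>t powr (g - 1)\<close> is not integrable at infinity, so Fubini is applied to the kernel damped by
  \<open>exp (- e * t)\<close>, and then \<open>e\<close> tends to zero.
\<close>

lemma frac_integral_damped:
  assumes "0 < g" "g < 1" "e > 0"
  shows "of_real (LINT t|lborel. indicator {0..} t * t powr (g - 1) * exp (- e * t) * u (y - t)) =
     of_real (Gamma g) * (LINT w|lborel. \<phi> w * ((of_real e + \<i> * w) powr (- of_real g) * cis (w * y)))"
proof -
  define f where "f t = complex_of_real (indicator {0..} t * (t powr (g - 1) * exp (- e * t)))" for t
  have f_int: "integrable lborel f"
    unfolding f_def using integrable_powr_exp[of "g - 1" e] assms by (intro integrable_of_real) auto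
  have "of_real (LINT t|lborel. indicator {0..} t * t powr (g - 1) * exp (- e * t) * u (y - t))
     = (LINT t|lborel. complex_of_real (indicator {0..} t * t powr (g - 1) * exp (- e * t) * u (y - t)))"
    by (rule integral_complex_of_real[symmetric])
  also have "\<dots> = (LINT t|lborel. f t * of_real (u (y - t)))"
    by (simp add: f_def mult_ac)
  also have "\<dots> = (LINT t|lborel. LINT w|lborel. \<phi> w * f t * cis (w * (y - t)))"
    unfolding representation by (simp add: mult_ac flip: integral_mult_right_zero)
  also have "\<dots> = (LINT w|lborel. LINT t|lborel. \<phi> w * f t * cis (w * (y - t)))"
    by (rule lborel_fubini_bounded_kernel[where C = 1]) (use f_int integrable_density in auto)
  also have "\<dots> = (LINT w|lborel. of_real (Gamma g) * (\<phi> w * ((of_real e + \<i> * w) powr (- of_real g) * cis (w * y))))"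
  proof (rule Bochner_Integration.integral_cong[OF refl])
    fix w
    have "(LINT t|lborel. \<phi> w * f t * cis (w * (y - t)))
        = (LINT t|lborel. (\<phi> w * cis (w * y)) *
            (of_real (indicator {0..} t * t powr (g - 1)) * exp (- (of_real e + \<i> * w) * of_real t)))"
    proof (rule Bochner_Integration.integral_cong[OF refl])
      fix t
      have "exp (- (of_real e + \<i> * w) * of_real t) = of_real (exp (- e * t)) * cis (- w * t)"
        unfolding cis_conv_exp exp_of_real[symmetric] exp_add[symmetric] by (simp add: algebra_simps)
      moreover have "cis (w * (y - t)) = cis (w * y) * cis (- w * t)"
        by (simp add: cis_mult algebra_simps)
      ultimately show "\<phi> w * f t * cis (w * (y - t)) = (\<phi> w * cis (w * y)) *
            (of_real (indicator {0..} t * t powr (g - 1)) * exp (- (of_real e + \<i> * w) * of_real t))"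
        by (simp only: f_def of_real_mult mult_ac)
    qed
    also have "\<dots> = (\<phi> w * cis (w * y)) * (of_real (Gamma g) * (of_real e + \<i> * w) powr (- of_real g))"
      unfolding integral_mult_right_zero using laplace_powr[of "g - 1" "of_real e + \<i> * w"] assms by simp
    finally show "(LINT t|lborel. \<phi> w * f t * cis (w * (y - t)))
        = of_real (Gamma g) * (\<phi> w * ((of_real e + \<i> * w) powr (- of_real g) * cis (w * y)))"
      by (simp add: mult_ac)
  qed
  also have "\<dots> = of_real (Gamma g) * (LINT w|lborel. \<phi> w * ((of_real e + \<i> * w) powr (- of_real g) * cis (w * y)))"
    by (rule integral_mult_right_zero)
  finally show ?thesis .
qed

lemma frac_integral_fourier:
  assumes "0 < g" "g < 1"
  shows "of_real (LINT t|lborel. indicator {0..} t * t powr (g - 1) * u (y - t)) =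
     of_real (Gamma g) * (LINT w|lborel. \<phi> w * ((\<i> * w) powr of_real (- g) * cis (w * y)))"
proof -
  define e where "e n = 1 / real (Suc n)" for n
  have e: "e n > 0" for n by (simp add: e_def)
  have e_lim: "e \<longlonglongrightarrow> 0" unfolding e_def by (intro LIMSEQ_Suc lim_const_over_n)
  have "(\<lambda>n. LINT t|lborel. indicator {0..} t * t powr (g - 1) * exp (- e n * t) * u (y - t))
      \<longlonglongrightarrow> (LINT t|lborel. indicator {0..} t * t powr (g - 1) * u (y - t))"
  proof (rule integral_dominated_convergence[where w = "\<lambda>t. norm (indicator {0..} t * t powr (g - 1) * u (y - t))"])
    show "AE t in lborel. (\<lambda>n. indicator {0..} t * t powr (g - 1) * exp (- e n * t) * u (y - t))
         \<longlonglongrightarrow> indicator {0..} t * t powr (g - 1) * u (y - t)"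
    proof (rule AE_I2)
      fix t :: real
      have "(\<lambda>n. indicator {0..} t * t powr (g - 1) * exp (- e n * t) * u (y - t))
         \<longlonglongrightarrow> indicator {0..} t * t powr (g - 1) * exp (- 0 * t) * u (y - t)"
        by (intro tendsto_intros e_lim)
      then show "(\<lambda>n. indicator {0..} t * t powr (g - 1) * exp (- e n * t) * u (y - t))
         \<longlonglongrightarrow> indicator {0..} t * t powr (g - 1) * u (y - t)" by simp
    qed
    have "exp (- e n * t) \<le> 1" if "t \<ge> 0" for n t
      using that e[of n] by simp
    then show "AE t in lborel. norm (indicator {0..} t * t powr (g - 1) * exp (- e n * t) * u (y - t))
         \<le> norm (indicator {0..} t * t powr (g - 1) * u (y - t))" for n
      by (intro AE_I2) (auto simp: indicator_def abs_mult intro!: mult_right_mono mult_left_le)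
  qed (use integrable_frac_integrand[OF assms, of y] in auto)
  then have lhs: "(\<lambda>n. complex_of_real (LINT t|lborel. indicator {0..} t * t powr (g - 1) * exp (- e n * t) * u (y - t)))
      \<longlonglongrightarrow> of_real (LINT t|lborel. indicator {0..} t * t powr (g - 1) * u (y - t))"
    by (rule tendsto_of_real)
  have damped_meas [measurable]: "(\<lambda>w::real. (of_real (e n) + \<i> * of_real w) powr - complex_of_real g) \<in> borel_measurable borel" for n
    using e[of n]
    by (intro borel_measurable_continuous_onI continuous_on_powr_complex continuous_intros)
       (auto simp: complex_eq_iff)
  have "(\<lambda>n. LINT w|lborel. \<phi> w * ((of_real (e n) + \<i> * w) powr (- of_real g) * cis (w * y)))
      \<longlonglongrightarrow> (LINT w|lborel. \<phi> w * ((\<i> * w) powr of_real (- g) * cis (w * y)))"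
  proof (rule integral_dominated_convergence[where w = "\<lambda>w. norm (\<phi> w * (\<i> * w) powr of_real (- g))"])
    show "integrable lborel (\<lambda>w. norm (\<phi> w * (\<i> * w) powr of_real (- g)))"
      using assms
      by (intro integrable_norm integrable_density_times[where p = "- g" and C = 1] measurable_imaginary_powr)
         (auto simp only: norm_imaginary_powr)
    show "AE w in lborel. (\<lambda>n. \<phi> w * ((of_real (e n) + \<i> * w) powr (- of_real g) * cis (w * y)))
       \<longlonglongrightarrow> \<phi> w * ((\<i> * w) powr of_real (- g) * cis (w * y))"
      using AE_lborel_singleton[of "0::real"]
    proof eventually_elim
      case (elim w)
      have "(\<lambda>n. of_real (e n) + \<i> * complex_of_real w) \<longlonglongrightarrow> of_real 0 + \<i> * w"
        by (intro tendsto_intros e_lim)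
      then have "(\<lambda>n. (of_real (e n) + \<i> * complex_of_real w) powr (- of_real g)) \<longlonglongrightarrow> (\<i> * w) powr (- of_real g)"
        using elim by (intro tendsto_powr_complex tendsto_const) (auto simp: complex_nonpos_Reals_iff)
      then show ?case
        unfolding of_real_minus by (intro tendsto_mult tendsto_const)
    qed
    show "AE w in lborel. norm (\<phi> w * ((of_real (e n) + \<i> * w) powr (- of_real g) * cis (w * y)))
        \<le> norm (\<phi> w * (\<i> * w) powr of_real (- g))" for n
      using AE_lborel_singleton[of "0::real"]
    proof eventually_elim
      case (elim w)
      have "\<bar>w\<bar> \<le> norm (of_real (e n) + \<i> * complex_of_real w)"
        using abs_Im_le_cmod[of "of_real (e n) + \<i> * complex_of_real w"] by simp
      then have "norm (of_real (e n) + \<i> * complex_of_real w) powr (- g) \<le> \<bar>w\<bar> powr (- g)"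
        using elim assms by (intro powr_mono2') auto
      moreover have "norm ((of_real (e n) + \<i> * complex_of_real w) powr (- of_real g)) =
          norm (of_real (e n) + \<i> * complex_of_real w) powr (- g)"
        by (simp add: norm_powr_real_powr')
      ultimately show ?case
        unfolding norm_mult norm_imaginary_powr by (auto intro!: mult_left_mono)
    qed
    show "(\<lambda>w. \<phi> w * ((\<i> * w) powr of_real (- g) * cis (w * y))) \<in> borel_measurable lborel"
      using measurable_imaginary_powr[of "-g"] by measurable
  qed measurable
  then have rhs: "(\<lambda>n. of_real (Gamma g) * (LINT w|lborel. \<phi> w * ((of_real (e n) + \<i> * w) powr (- of_real g) * cis (w * y))))
      \<longlonglongrightarrow> of_real (Gamma g) * (LINT w|lborel. \<phi> w * ((\<i> * w) powr of_real (- g) * cis (w * y)))"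
    by (intro tendsto_intros)
  show ?thesis
    using LIMSEQ_unique[OF lhs rhs[folded frac_integral_damped[OF assms e]]] .
qed

end

section \<open>The coefficients and their generating function on the closed disc\<close>

lemma of_real_gbinomial: "of_real (x gchoose k) = (of_real x gchoose k :: 'a::real_field)"
  by (simp add: gbinomial_prod_rev)

lemma gbinomial_Suc_alternating:
  "(-1) ^ Suc n * ((x::real) gchoose Suc n) = (-1) ^ n * (x gchoose n) * ((real n - x) / real (Suc n))"
  by (simp add: gbinomial_prod_rev field_simps)

lemma gbinomial_alternating_nonneg:
  fixes x :: real
  assumes "0 \<le> (-1) ^ m * (x gchoose m)" "x \<le> real m" "m \<le> n"
  shows "0 \<le> (-1) ^ n * (x gchoose n)"
  using assms(3)
proof (induction n rule: dec_induct)
  case (step n)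
  then show ?case
    unfolding gbinomial_Suc_alternating using assms(2) by (rule_tac mult_nonneg_nonneg) auto
qed (use assms in simp)

lemma gbinomial_alternating_nonpos:
  fixes x :: real
  assumes "(-1) ^ m * (x gchoose m) \<le> 0" "x \<le> real m" "m \<le> n"
  shows "(-1) ^ n * (x gchoose n) \<le> 0"
  using assms(3)
proof (induction n rule: dec_induct)
  case (step n)
  then show ?case
    unfolding gbinomial_Suc_alternating using assms(2) by (rule_tac mult_nonpos_nonneg) auto
qed (use assms in simp)

text \<open>
  For \<open>k \<ge> 2\<close> the numbers \<open>(-1) ^ k * (\<alpha> gchoose k)\<close> are nonnegative, and their partial
  sums are bounded by the telescoping identity \<open>gbinomial_sum_lower_neg\<close>.
\<close>

lemma summable_abs_gbinomial:
  assumes "1 < \<alpha>" "\<alpha> < (2::real)"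
  shows "summable (\<lambda>k. \<bar>\<alpha> gchoose k\<bar>)"
proof (rule summableI_nonneg_bounded)
  have abs_eq: "\<bar>\<alpha> gchoose k\<bar> = (\<alpha> gchoose k) * (-1) ^ k + (if k = 1 then 2 * \<alpha> else 0)" for k
  proof -
    consider "k = 0" | "k = 1" | "k \<ge> 2" by linarith
    then show ?thesis
    proof cases
      case 3
      have "(-1) ^ 2 * (\<alpha> gchoose 2) \<ge> 0"
        using assms by (simp add: gbinomial_prod_rev numeral_2_eq_2)
      then have "(-1) ^ k * (\<alpha> gchoose k) \<ge> 0"
        using 3 assms by (rule_tac gbinomial_alternating_nonneg[of 2]) auto
      then have "\<bar>(-1) ^ k * (\<alpha> gchoose k)\<bar> = (-1) ^ k * (\<alpha> gchoose k)" by simp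
      then show ?thesis using 3 by (simp add: abs_mult power_abs mult.commute)
    qed (use assms in auto)
  qed
  show "(\<Sum>k<n. \<bar>\<alpha> gchoose k\<bar>) \<le> 1 + 2 * \<alpha>" for n
  proof (cases n)
    case (Suc m)
    have "(\<Sum>k<n. \<bar>\<alpha> gchoose k\<bar>) = (\<Sum>k\<le>m. (\<alpha> gchoose k) * (-1) ^ k) + (\<Sum>k\<le>m. if k = 1 then 2 * \<alpha> else 0)"
      unfolding abs_eq Suc lessThan_Suc_atMost by (rule sum.distrib)
    also have "(\<Sum>k\<le>m. if k = 1 then 2 * \<alpha> else 0) \<le> 2 * \<alpha>"
      using assms by simp
    also have "(\<Sum>k\<le>m. (\<alpha> gchoose k) * (-1) ^ k) \<le> 1"
    proof (cases "m = 0")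
      case False
      have "(-1) ^ m * (\<alpha> - 1 gchoose m) \<le> 0"
        using False assms by (rule_tac gbinomial_alternating_nonpos[of 1]) auto
      then show ?thesis by (simp add: gbinomial_sum_lower_neg)
    qed simp
    finally show ?thesis by simp
  qed (use assms in simp)
qed simp

text \<open>
  The first factor may lie on the imaginary axis, as \<open>s = \<i> \<theta>\<close> does below.
\<close>

lemma powr_mult_Re_pos:
  assumes "Re v \<ge> 0" "v \<noteq> 0" "Re w > 0"
  shows "(v * w) powr s = v powr s * w powr s"
proof -
  have "w \<noteq> 0" using assms by auto
  have "\<bar>Im (Ln v)\<bar> \<le> pi / 2" using assms Re_Ln_pos_le by simp
  moreover have "\<bar>Im (Ln w)\<bar> < pi / 2" using assms \<open>w \<noteq> 0\<close> Re_Ln_pos_lt by simp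
  ultimately have "Ln (v * w) = Ln v + Ln w"
    using assms \<open>w \<noteq> 0\<close> by (intro Ln_times_simple) (auto simp: abs_le_iff abs_less_iff)
  then show ?thesis
    using assms \<open>w \<noteq> 0\<close> by (simp add: powr_def exp_add algebra_simps)
qed

text \<open>
  Throughout, \<open>a\<close> and \<open>c\<close> are the coefficients of the second factor in
  \<open>gen2 \<alpha> z = (1 - z) (a + c z)\<close>.
\<close>

context
  fixes \<alpha> a c :: real
  assumes \<alpha>: "1 < \<alpha>" "\<alpha> < 2"
  defines "a \<equiv> (3 * \<alpha> - 2) / (2 * \<alpha>)" and "c \<equiv> (2 - \<alpha>) / (2 * \<alpha>)"
begin

lemma gen2_coeffs: "0 < c" "c < a" "a + c = 1"
  using \<alpha> by (auto simp: a_def c_def field_simps)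

lemma Re_second_factor_pos:
  assumes "norm z \<le> 1"
  shows "Re (of_real a + of_real c * z) > 0"
proof -
  have "\<bar>Re z\<bar> \<le> 1" using abs_Re_le_cmod[of z] assms by linarith
  then have "c * (-1) \<le> c * Re z" using gen2_coeffs by (intro mult_left_mono) auto
  then show ?thesis using gen2_coeffs by simp
qed

lemma first_factor_summable:
  assumes "norm z \<le> 1"
  shows "summable (\<lambda>n. norm ((of_real \<alpha> gchoose n) * (- z :: complex) ^ n))"
proof (rule summable_comparison_test'[OF summable_abs_gbinomial[OF \<alpha>]])
  have "norm ((of_real \<alpha> gchoose n) :: complex) = \<bar>\<alpha> gchoose n\<bar>" for n
    by (metis norm_of_real of_real_gbinomial)
  then show "norm (norm ((of_real \<alpha> gchoose n) * (- z :: complex) ^ n)) \<le> \<bar>\<alpha> gchoose n\<bar>" for n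
    using power_le_one[of "norm z" n] assms by (simp add: norm_mult norm_power mult_left_le)
qed

text \<open>
  The binomial series of \<open>(1 - z)\<^sup>\<alpha>\<close> is extended from the open to the closed disc by continuity.
\<close>

lemma first_factor_sums:
  assumes "norm (z::complex) \<le> 1"
  shows "(\<lambda>n. (of_real \<alpha> gchoose n) * (- z) ^ n) sums (1 - z) powr of_real \<alpha>"
proof -
  let ?f = "\<lambda>n (z::complex). (of_real \<alpha> gchoose n) * (- z) ^ n"
  let ?d = "\<lambda>z. (\<Sum>n. ?f n z) - (1 - z) powr of_real \<alpha>"
  have "uniform_limit (cball 0 1) (\<lambda>n z. \<Sum>i<n. ?f i z) (\<lambda>z. \<Sum>i. ?f i z) sequentially"
  proof (rule Weierstrass_m_test[OF _ summable_abs_gbinomial[OF \<alpha>]])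
    fix n and z :: complex assume "z \<in> cball 0 1"
    moreover have "norm ((of_real \<alpha> gchoose n) :: complex) = \<bar>\<alpha> gchoose n\<bar>"
      by (metis norm_of_real of_real_gbinomial)
    ultimately show "norm (?f n z) \<le> \<bar>\<alpha> gchoose n\<bar>"
      using power_le_one[of "norm z" n] by (simp add: norm_mult norm_power mult_left_le)
  qed
  then have "continuous_on (cball 0 1) (\<lambda>z. \<Sum>i. ?f i z)"
    by (rule uniform_limit_theorem[rotated]) (auto intro!: always_eventually continuous_intros)
  moreover have "Re (z :: complex) \<le> 1" if "norm z \<le> 1" for z
    using complex_Re_le_cmod[of z] that by linarith
  then have "continuous_on (cball 0 1) (\<lambda>z. (1 - z) powr of_real \<alpha> :: complex)"
    using \<alpha> by (intro continuous_on_powr_complex continuous_intros) auto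
  ultimately have "continuous_on (closure (ball 0 1)) ?d"
    by (simp add: continuous_on_diff)
  moreover have "?d z = 0" if "z \<in> ball 0 1" for z
    using gen_binomial_complex[of "-z" "of_real \<alpha>"] that by (simp add: sums_iff)
  ultimately have "?d z = 0"
    using assms by (rule_tac continuous_constant_on_closure[of "ball 0 1" ?d 0 z]) auto
  then show ?thesis
    using summable_norm_cancel[OF first_factor_summable[OF assms]] by (simp add: sums_iff)
qed

lemma second_factor_sums:
  assumes "norm (z::complex) \<le> 1"
  shows "(\<lambda>n. of_real (a powr \<alpha>) * ((of_real \<alpha> gchoose n) * (of_real (c / a) * z) ^ n))
           sums (of_real a + of_real c * z) powr of_real \<alpha>"
proof -
  have "0 < c / a" "c / a < 1" using gen2_coeffs by auto
  then have "norm (of_real (c / a) * z) < 1"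
  proof -
    have "c * norm z \<le> c * 1" using gen2_coeffs assms by (intro mult_left_mono) auto
    then have "c * norm z < a" using gen2_coeffs by linarith
    then show ?thesis using gen2_coeffs by (simp add: norm_mult norm_divide pos_divide_less_eq)
  qed
  then have "(\<lambda>n. (of_real \<alpha> gchoose n) * (of_real (c / a) * z) ^ n) sums (1 + of_real (c / a) * z) powr of_real \<alpha>"
    by (rule gen_binomial_complex)
  then have "(\<lambda>n. of_real (a powr \<alpha>) * ((of_real \<alpha> gchoose n) * (of_real (c / a) * z) ^ n))
     sums (of_real (a powr \<alpha>) * (1 + of_real (c / a) * z) powr of_real \<alpha>)"
    by (rule sums_mult)
  also have "of_real (a powr \<alpha>) * (1 + of_real (c / a) * z) powr of_real \<alpha>
     = (of_real a * (1 + of_real (c / a) * z)) powr of_real \<alpha>"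
    using gen2_coeffs by (subst powr_times_real_left) (auto simp: powr_of_real)
  also have "of_real a * (1 + of_real (c / a) * z) = of_real a + of_real c * z"
    using gen2_coeffs by (simp add: field_simps)
  finally show ?thesis .
qed

lemma second_factor_summable:
  assumes "norm (z::complex) \<le> 1"
  shows "summable (\<lambda>n. norm (of_real (a powr \<alpha>) * ((of_real \<alpha> gchoose n) * (of_real (c / a) * z) ^ n)))"
proof (rule summable_comparison_test'[OF summable_mult[OF summable_abs_gbinomial[OF \<alpha>], of "a powr \<alpha>"]])
  have c: "0 < c / a" "c / a < 1" using gen2_coeffs by auto
  have "norm (of_real (c / a) * z) \<le> 1"
    using assms c gen2_coeffs mult_mono[of "c / a" 1 "norm z" 1] by (simp add: norm_mult del: of_real_divide)
  then have le: "norm ((of_real (c / a) * z) ^ n) \<le> 1" for n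
    unfolding norm_power by (intro power_le_one) auto
  show "norm (norm (of_real (a powr \<alpha>) * ((of_real \<alpha> gchoose n) * (of_real (c / a) * z) ^ n)))
          \<le> a powr \<alpha> * \<bar>\<alpha> gchoose n\<bar>" for n
  proof -
    have eq: "norm ((of_real \<alpha> gchoose n) :: complex) = \<bar>\<alpha> gchoose n\<bar>"
      by (metis norm_of_real of_real_gbinomial)
    show ?thesis
      unfolding real_norm_def abs_norm_cancel norm_mult[of "of_real (a powr \<alpha>)"] norm_mult[of "of_real \<alpha> gchoose n"] eq
      using le[of n] by (auto intro!: mult_left_mono mult_left_le)
  qed
qed

text \<open>
  The Cauchy product of the coefficients of \<open>(1 - z)\<^sup>\<alpha>\<close> and \<open>(a + c z)\<^sup>\<alpha>\<close>; it equals
  \<open>kappa2 \<alpha>\<close> (\<open>kappa2_eq\<close>).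
\<close>

definition kappa_conv :: "nat \<Rightarrow> real" where
  "kappa_conv l = (\<Sum>i\<le>l. (\<alpha> gchoose i) * (-1) ^ i * (a powr \<alpha> * ((\<alpha> gchoose (l - i)) * (c / a) ^ (l - i))))"

lemma kappa_conv_times_power:
  "of_real (kappa_conv l) * (z::complex) ^ l =
     (\<Sum>i\<le>l. ((of_real \<alpha> gchoose i) * (- z) ^ i) *
        (of_real (a powr \<alpha>) * ((of_real \<alpha> gchoose (l - i)) * (of_real (c / a) * z) ^ (l - i))))"
  unfolding kappa_conv_def of_real_sum sum_distrib_right
proof (rule sum.cong[OF refl])
  fix i assume "i \<in> {..l}"
  then have "z ^ l = z ^ i * z ^ (l - i)" by (simp flip: power_add)
  then have "of_real ((\<alpha> gchoose i) * (-1) ^ i * (a powr \<alpha> * ((\<alpha> gchoose (l - i)) * (c / a) ^ (l - i)))) * z ^ l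
     = ((of_real \<alpha> gchoose i) * ((-1) ^ i * z ^ i)) *
        (of_real (a powr \<alpha>) * ((of_real \<alpha> gchoose (l - i)) * (of_real (c / a) ^ (l - i) * z ^ (l - i))))"
    by (simp add: of_real_gbinomial mult_ac)
  then show "of_real ((\<alpha> gchoose i) * (-1) ^ i * (a powr \<alpha> * ((\<alpha> gchoose (l - i)) * (c / a) ^ (l - i)))) * z ^ l =
     ((of_real \<alpha> gchoose i) * (- z) ^ i) *
        (of_real (a powr \<alpha>) * ((of_real \<alpha> gchoose (l - i)) * (of_real (c / a) * z) ^ (l - i)))"
    by (simp only: power_mult_distrib power_minus[of z i])
qed

lemma kappa_conv_sums:
  assumes "norm (z::complex) \<le> 1"
  shows "(\<lambda>l. of_real (kappa_conv l) * z ^ l) sums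
          ((1 - z) powr of_real \<alpha> * (of_real a + of_real c * z) powr of_real \<alpha>)"
  using Cauchy_product_sums[OF first_factor_summable[OF assms] second_factor_summable[OF assms]]
  by (simp only: kappa_conv_times_power sums_unique[OF first_factor_sums[OF assms], symmetric]
        sums_unique[OF second_factor_sums[OF assms], symmetric])

lemma kappa2_eq: "kappa2 \<alpha> = kappa_conv"
proof (rule kappa2_unique[OF \<alpha>])
  fix z :: complex assume z: "norm z < 1"
  have "Re z < 1" using complex_Re_le_cmod[of z] z by linarith
  moreover have "z \<noteq> 1" using z by auto
  ultimately have "gen2 \<alpha> z powr of_real \<alpha> = (1 - z) powr of_real \<alpha> * (of_real a + of_real c * z) powr of_real \<alpha>"
    unfolding gen2_factor[OF less_imp_neq[OF less_trans[OF zero_less_one \<alpha>(1)], symmetric]]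
    using Re_second_factor_pos[of z] z unfolding a_def c_def by (subst powr_mult_Re_pos) auto
  then show "(\<lambda>l. of_real (kappa_conv l) * z ^ l) sums (gen2 \<alpha> z powr of_real \<alpha>)"
    using kappa_conv_sums[of z] z by simp
qed

lemma kappa2_summable: "summable (\<lambda>l. \<bar>kappa2 \<alpha> l\<bar>)"
proof -
  have "summable (\<lambda>l. \<Sum>i\<le>l. norm ((of_real \<alpha> gchoose i) * (- 1 :: complex) ^ i) *
        norm (of_real (a powr \<alpha>) * ((of_real \<alpha> gchoose (l - i)) * (of_real (c / a) * (1::complex)) ^ (l - i))))"
    using first_factor_summable[of 1] second_factor_summable[of 1]
    by (intro summable_Cauchy_product) (auto simp del: of_real_divide)
  then show ?thesis
  proof (rule summable_comparison_test')
    fix l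
    have "norm (of_real (kappa_conv l) * (1::complex) ^ l) \<le> (\<Sum>i\<le>l. norm ((of_real \<alpha> gchoose i) * (- 1 :: complex) ^ i) *
        norm (of_real (a powr \<alpha>) * ((of_real \<alpha> gchoose (l - i)) * (of_real (c / a) * (1::complex)) ^ (l - i))))"
      unfolding kappa_conv_times_power norm_mult[symmetric] by (rule norm_sum)
    then show "norm \<bar>kappa2 \<alpha> l\<bar> \<le> (\<Sum>i\<le>l. norm ((of_real \<alpha> gchoose i) * (- 1 :: complex) ^ i) *
        norm (of_real (a powr \<alpha>) * ((of_real \<alpha> gchoose (l - i)) * (of_real (c / a) * (1::complex)) ^ (l - i))))"
      by (simp add: kappa2_eq)
  qed
qed

lemma kappa2_sums_closed_disc:
  assumes "norm (z::complex) \<le> 1"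
  shows "(\<lambda>l. of_real (kappa2 \<alpha> l) * z ^ l) sums
          ((1 - z) powr of_real \<alpha> * (of_real a + of_real c * z) powr of_real \<alpha>)"
  using kappa_conv_sums[OF assms] by (simp add: kappa2_eq)

end

section \<open>Expansion of the symbol\<close>

lemma Ln_approx_quadratic:
  assumes "norm (w::complex) \<le> 1 / 2"
  shows "norm (Ln (1 + w) - (w - w\<^sup>2 / 2)) \<le> 2 * norm w ^ 3"
proof -
  let ?L = "\<lambda>z::complex. Ln (1 + z) - (z - z\<^sup>2 / 2)"
  have "norm (?L w - ?L 0) \<le> (2 * (norm w)\<^sup>2) * norm (w - 0)"
  proof (rule field_differentiable_bound[of "cball 0 (norm w)" _ "\<lambda>z. z\<^sup>2 / (1 + z)"])
    fix z :: complex assume "z \<in> cball 0 (norm w)"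
    then have z: "norm z \<le> norm w" by simp
    then have "\<bar>Re z\<bar> \<le> 1 / 2" using abs_Re_le_cmod[of z] assms by linarith
    then have Re: "Re (1 + z) > 0" by simp
    have nz: "1 + z \<noteq> 0"
    proof
      assume "1 + z = 0"
      then have "Re (1 + z) = Re 0" by (rule arg_cong)
      then show False using Re by simp
    qed
    have "(?L has_field_derivative (1 / (1 + z) - (1 - z))) (at z within cball 0 (norm w))"
      unfolding divide_inverse[of 1] mult_1
      using Re by (auto intro!: derivative_eq_intros simp: complex_nonpos_Reals_iff)
    also have "1 / (1 + z) - (1 - z) = z\<^sup>2 / (1 + z)"
    proof -
      have "(1 - z) * (1 + z) = 1 - z\<^sup>2" by (simp add: algebra_simps power2_eq_square)
      then have "1 - z = (1 - z\<^sup>2) / (1 + z)" using nz by (simp add: nonzero_eq_divide_eq)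
      then show ?thesis by (simp only: diff_divide_distrib) simp
    qed
    finally show "(?L has_field_derivative z\<^sup>2 / (1 + z)) (at z within cball 0 (norm w))" .
    have "norm (1 + z) \<ge> 1 / 2"
      using norm_triangle_ineq4[of "1 + z" z] z assms by simp
    then have "norm z ^ 2 / norm (1 + z) \<le> norm w ^ 2 / (1 / 2)"
      using z by (intro frac_le power_mono) auto
    then show "norm (z\<^sup>2 / (1 + z)) \<le> 2 * (norm w)\<^sup>2"
      by (simp add: norm_divide norm_power)
  qed auto
  then show ?thesis by (simp add: eval_nat_numeral mult.assoc)
qed

lemma exp_taylor_bigo:
  "(\<lambda>s::complex. exp s - (\<Sum>k\<le>n. s ^ k / fact k)) \<in> O[at 0](\<lambda>s. s ^ Suc n)"
proof (rule bigoI[where c = "exp 1 / fact n"])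
  have "\<forall>\<^sub>F s::complex in at 0. s \<in> ball 0 1"
    by (intro eventually_at_in_open') auto
  then show "\<forall>\<^sub>F s::complex in at 0. norm (exp s - (\<Sum>k\<le>n. s ^ k / fact k)) \<le> exp 1 / fact n * norm (s ^ Suc n)"
  proof eventually_elim
    case (elim s)
    have "norm (exp s - (\<Sum>k\<le>n. s ^ k / fact k)) \<le> exp (norm s) * norm s ^ Suc n / fact n"
      by (rule Taylor_exp_field)
    also have "\<dots> \<le> exp 1 * norm s ^ Suc n / fact n"
      using elim by (intro divide_right_mono mult_right_mono) auto
    finally show ?case by (simp add: norm_mult norm_power)
  qed
qed

lemma power_bigo_power:
  "m \<le> n \<Longrightarrow> (\<lambda>s::complex. s ^ n) \<in> O[at 0](\<lambda>s. s ^ m)"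
proof (rule bigoI[where c = 1])
  assume "m \<le> n"
  have "\<forall>\<^sub>F s::complex in at 0. s \<in> ball 0 1"
    by (intro eventually_at_in_open') auto
  then show "\<forall>\<^sub>F s::complex in at 0. norm (s ^ n) \<le> 1 * norm (s ^ m)"
    by eventually_elim (use \<open>m \<le> n\<close> in \<open>auto simp: norm_power intro!: power_decreasing\<close>)
qed

lemma bigo_tendsto_0:
  fixes f g :: "'a \<Rightarrow> complex"
  assumes "f \<in> O[F](g)" and g: "(g \<longlongrightarrow> 0) F"
  shows "(f \<longlongrightarrow> 0) F"
proof -
  obtain C where "\<forall>\<^sub>F x in F. norm (f x) \<le> C * norm (g x)"
    using assms(1) by (rule landau_o.bigE)
  moreover have "((\<lambda>x. C * norm (g x)) \<longlongrightarrow> 0) F"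
    using tendsto_mult_left[OF tendsto_norm_zero[OF g], of C] by simp
  ultimately show ?thesis by (rule Lim_null_comparison)
qed

text \<open>
  If \<open>w = b s + d s\<^sup>2 + O(s\<^sup>3)\<close>, then \<open>Ln (1 + w) = b s + (d - b\<^sup>2 / 2) s\<^sup>2 + O(s\<^sup>3)\<close>.
\<close>

lemma Ln_expansion:
  fixes w :: "complex \<Rightarrow> complex"
  assumes w: "(\<lambda>s. w s - (b * s + d * s\<^sup>2)) \<in> O[at 0](\<lambda>s. s ^ 3)"
  shows "(\<lambda>s. Ln (1 + w s) - (b * s + (d - b\<^sup>2 / 2) * s\<^sup>2)) \<in> O[at 0](\<lambda>s. s ^ 3)"
    and "(w \<longlongrightarrow> 0) (at 0)"
proof -
  have ds: "(\<lambda>s. C * s ^ n) \<in> O[at 0](\<lambda>s. s ^ n)" for C :: complex and n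
    by (rule bigoI[where c = "norm C"]) (simp add: norm_mult)
  have "(\<lambda>s. (w s - (b * s + d * s\<^sup>2)) + d * s\<^sup>2) \<in> O[at 0](\<lambda>s. s ^ 2)"
    by (rule sum_in_bigo(1)[OF landau_o.big_trans[OF w power_bigo_power] ds]) simp
  also have "(\<lambda>s. (w s - (b * s + d * s\<^sup>2)) + d * s\<^sup>2) = (\<lambda>s. w s - b * s)"
    by (simp add: fun_eq_iff)
  finally have w2: "(\<lambda>s. w s - b * s) \<in> O[at 0](\<lambda>s. s ^ 2)" .
  note bs = ds[where n = 1, unfolded power_one_right]
  have w2': "(\<lambda>s. w s - b * s) \<in> O[at 0](\<lambda>s. s)"
    using landau_o.big_trans[OF w2 power_bigo_power[of 1 2]] by (simp only: power_one_right)
  have "(\<lambda>s. (w s - b * s) + b * s) \<in> O[at 0](\<lambda>s. s)"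
    by (rule sum_in_bigo(1)[OF w2' bs])
  also have "(\<lambda>s. (w s - b * s) + b * s) = w" by (simp add: fun_eq_iff)
  finally have w1: "w \<in> O[at 0](\<lambda>s. s)" .
  have w1': "(\<lambda>s. w s + b * s) \<in> O[at 0](\<lambda>s. s)"
    by (rule sum_in_bigo(1)[OF w1 bs])
  show lim: "(w \<longlongrightarrow> 0) (at 0)"
    by (rule bigo_tendsto_0[OF w1]) (rule tendsto_ident_at)
  have "\<forall>\<^sub>F s in at 0. norm (w s) < 1 / 2"
    using tendstoD[OF lim, of "1/2"] by simp
  then have "\<forall>\<^sub>F s in at 0. norm (Ln (1 + w s) - (w s - (w s)\<^sup>2 / 2)) \<le> 2 * norm ((w s) ^ 3)"
    by eventually_elim (simp add: norm_power Ln_approx_quadratic)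
  then have "(\<lambda>s. Ln (1 + w s) - (w s - (w s)\<^sup>2 / 2)) \<in> O[at 0](\<lambda>s. (w s) ^ 3)"
    by (rule bigoI)
  also have "(\<lambda>s. (w s) ^ 3) \<in> O[at 0](\<lambda>s. s ^ 3)"
    by (rule landau_o.big_power[OF w1])
  finally have L: "(\<lambda>s. Ln (1 + w s) - (w s - (w s)\<^sup>2 / 2)) \<in> O[at 0](\<lambda>s. s ^ 3)" .
  have "(\<lambda>s. (1 / 2) * ((w s - b * s) * (w s + b * s))) \<in> O[at 0](\<lambda>s. s ^ 2 * s)"
    by (subst landau_o.big.cmult_in_iff) (auto intro: landau_o.big.mult[OF w2 w1'])
  also have "(\<lambda>s::complex. s ^ 2 * s) = (\<lambda>s. s ^ 3)"
    by (simp add: fun_eq_iff power2_eq_square power3_eq_cube)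
  finally have q: "(\<lambda>s. (1 / 2) * ((w s - b * s) * (w s + b * s))) \<in> O[at 0](\<lambda>s. s ^ 3)" .
  have "(\<lambda>s. (Ln (1 + w s) - (w s - (w s)\<^sup>2 / 2)) + (w s - (b * s + d * s\<^sup>2)) -
      (1 / 2) * ((w s - b * s) * (w s + b * s))) \<in> O[at 0](\<lambda>s. s ^ 3)"
    by (rule sum_in_bigo(2)[OF sum_in_bigo(1)[OF L w] q])
  also have "(\<lambda>s. (Ln (1 + w s) - (w s - (w s)\<^sup>2 / 2)) + (w s - (b * s + d * s\<^sup>2)) -
      (1 / 2) * ((w s - b * s) * (w s + b * s))) = (\<lambda>s. Ln (1 + w s) - (b * s + (d - b\<^sup>2 / 2) * s\<^sup>2))"
    by (simp add: fun_eq_iff algebra_simps power2_eq_square)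
  finally show "(\<lambda>s. Ln (1 + w s) - (b * s + (d - b\<^sup>2 / 2) * s\<^sup>2)) \<in> O[at 0](\<lambda>s. s ^ 3)" .
qed

lemma exp_expansions:
  "(\<lambda>s::complex. exp s - (1 + s + s\<^sup>2 / 2)) \<in> O[at 0](\<lambda>s. s ^ 3)"
  "(\<lambda>s::complex. exp (- s) - (1 - s + s\<^sup>2 / 2)) \<in> O[at 0](\<lambda>s. s ^ 3)"
  "(\<lambda>s::complex. exp (- s) - (1 - s + s\<^sup>2 / 2 - s ^ 3 / 6)) \<in> O[at 0](\<lambda>s. s ^ 4)"
proof -
  have "filterlim (\<lambda>s::complex. - s) (nhds 0) (at 0)"
    using tendsto_minus[OF tendsto_ident_at[of "0::complex" UNIV]] by simp
  then have neg_lim: "filterlim (\<lambda>s::complex. - s) (at 0) (at 0)"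
    by (intro filterlim_atI) (auto simp: eventually_at_filter)
  have exp_neg: "(\<lambda>s::complex. exp (- s) - (\<Sum>k\<le>n. (- s) ^ k / fact k)) \<in> O[at 0](\<lambda>s. s ^ Suc n)" for n
  proof -
    have "(\<lambda>s::complex. exp (- s) - (\<Sum>k\<le>n. (- s) ^ k / fact k)) \<in> O[at 0](\<lambda>s. (- s) ^ Suc n)"
      by (rule landau_o.big.compose[OF exp_taylor_bigo[of n] neg_lim])
    also have "(\<lambda>s::complex. (- s) ^ Suc n) \<in> O[at 0](\<lambda>s. s ^ Suc n)"
      by (rule bigoI[where c = 1]) (simp add: norm_mult norm_power)
    finally show ?thesis .
  qed
  show "(\<lambda>s::complex. exp s - (1 + s + s\<^sup>2 / 2)) \<in> O[at 0](\<lambda>s. s ^ 3)"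
    using exp_taylor_bigo[of 2] by (simp add: eval_nat_numeral)
  show "(\<lambda>s::complex. exp (- s) - (1 - s + s\<^sup>2 / 2)) \<in> O[at 0](\<lambda>s. s ^ 3)"
    using exp_neg[of 2] by (simp add: eval_nat_numeral)
  show "(\<lambda>s::complex. exp (- s) - (1 - s + s\<^sup>2 / 2 - s ^ 3 / 6)) \<in> O[at 0](\<lambda>s. s ^ 4)"
    using exp_neg[of 3] by (simp add: eval_nat_numeral)
qed

lemma backward_difference_expansion:
  "(\<lambda>s::complex. ((1 - exp (- s)) / s - 1) - ((- 1 / 2) * s + (1 / 6) * s\<^sup>2)) \<in> O[at 0](\<lambda>s. s ^ 3)"
proof -
  have nz: "\<forall>\<^sub>F s::complex in at 0. s \<noteq> 0" by (simp add: eventually_at_filter)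
  have "(\<lambda>s::complex. (exp (- s) - (1 - s + s\<^sup>2 / 2 - s ^ 3 / 6)) / s) \<in> O[at 0](\<lambda>s. s ^ 4 / s)"
    by (intro landau_o.big.divide_right nz exp_expansions(3))
  also have "(\<lambda>s::complex. s ^ 4 / s) \<in> O[at 0](\<lambda>s. s ^ 3)"
    by (intro bigoI[where c = 1] eventually_mono[OF nz]) (simp add: norm_divide norm_power eval_nat_numeral)
  finally have *: "(\<lambda>s::complex. (exp (- s) - (1 - s + s\<^sup>2 / 2 - s ^ 3 / 6)) / s) \<in> O[at 0](\<lambda>s. s ^ 3)" .
  have eq: "((1 - exp (- s)) / s - 1) - ((- 1 / 2) * s + (1 / 6) * s\<^sup>2)
      = - ((exp (- s) - (1 - s + s\<^sup>2 / 2 - s ^ 3 / 6)) / s)" if "s \<noteq> 0" for s :: complex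
  proof -
    have "- ((exp (- s) - (1 - s + s\<^sup>2 / 2 - s ^ 3 / 6)) / s) = (1 - exp (- s)) / s - s / s + s\<^sup>2 / s / 2 - s ^ 3 / s / 6"
      by (simp add: diff_divide_distrib add_divide_distrib mult.commute)
    then show ?thesis using that by (simp add: power2_eq_square power3_eq_cube)
  qed
  have "(\<lambda>s::complex. - ((exp (- s) - (1 - s + s\<^sup>2 / 2 - s ^ 3 / 6)) / s)) \<in> O[at 0](\<lambda>s. s ^ 3)"
    using * by (simp only: landau_o.big.uminus_in_iff)
  then show ?thesis
    by (subst landau_o.big.in_cong[OF eventually_mono[OF nz eq]])
qed

lemma exp_minus_1_bigo:
  fixes p :: "complex \<Rightarrow> complex"
  assumes p: "p \<in> O[at 0](\<lambda>s. s ^ 2)"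
  shows "(\<lambda>s. exp (p s) - 1 - p s) \<in> O[at 0](\<lambda>s. s ^ 3)"
proof -
  have "((\<lambda>s::complex. s ^ 2) \<longlongrightarrow> 0) (at 0)"
    using tendsto_power[OF tendsto_ident_at[of "0::complex" UNIV], of 2] by simp
  then have p_lim: "(p \<longlongrightarrow> 0) (at 0)"
    by (rule bigo_tendsto_0[OF p])
  have "\<forall>\<^sub>F s in at 0. norm (p s) < 1" using tendstoD[OF p_lim, of 1] by simp
  then have "\<forall>\<^sub>F s in at 0. norm (exp (p s) - 1 - p s) \<le> exp 1 * norm ((p s) ^ 2)"
  proof eventually_elim
    case (elim s)
    have "norm (exp (p s) - 1 - p s) \<le> exp (norm (p s)) * norm (p s) ^ 2"
      using Taylor_exp_field[of "p s" 1] by (simp add: power2_eq_square diff_diff_eq)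
    also have "\<dots> \<le> exp 1 * norm (p s) ^ 2"
      using elim by (intro mult_right_mono) auto
    finally show ?case by (simp add: norm_power)
  qed
  then have "(\<lambda>s. exp (p s) - 1 - p s) \<in> O[at 0](\<lambda>s. (p s) ^ 2)"
    by (rule bigoI)
  also have "(\<lambda>s. (p s) ^ 2) \<in> O[at 0](\<lambda>s. (s ^ 2) ^ 2)"
    by (rule landau_o.big_power[OF p])
  also have "(\<lambda>s::complex. (s ^ 2) ^ 2) \<in> O[at 0](\<lambda>s. s ^ 3)"
    using power_bigo_power[of 3 4] by (simp flip: power_mult)
  finally show ?thesis .
qed

context
  fixes \<alpha> a c :: real
  assumes \<alpha>: "1 < \<alpha>" "\<alpha> < 2"
  defines "a \<equiv> (3 * \<alpha> - 2) / (2 * \<alpha>)" and "c \<equiv> (2 - \<alpha>) / (2 * \<alpha>)"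
begin

text \<open>
  Here \<open>LE\<close> and \<open>LV\<close> stand for the logarithms of \<open>(1 - e\<^sup>-\<^sup>s) / s\<close> and
  \<open>a + c e\<^sup>-\<^sup>s\<close>; the terms subtracted on the right are their second order expansions. The
  identity says that the linear terms cancel, because \<open>\<alpha> / 2 + \<alpha> c = 1\<close>, and that the
  quadratic terms add up to \<open>sigma2 \<alpha>\<close>.
\<close>

lemma log_symbol_identity:
  fixes s LE LV :: complex
  shows "s + of_real \<alpha> * LE + of_real \<alpha> * LV - of_real (sigma2 \<alpha>) * s\<^sup>2
    = of_real \<alpha> * (LE - ((- 1 / 2) * s + (1 / 6 - (- 1 / 2)\<^sup>2 / 2) * s\<^sup>2))
      + of_real \<alpha> * (LV - ((- of_real c) * s + (of_real c / 2 - (- of_real c)\<^sup>2 / 2) * s\<^sup>2))"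
proof -
  have "\<alpha> * (1 / 2) + \<alpha> * c = 1" using \<alpha> by (simp add: c_def field_simps)
  then have "complex_of_real (\<alpha> * (1 / 2) + \<alpha> * c) = of_real 1" by (simp only:)
  then have lin: "complex_of_real \<alpha> * (1 / 2) + of_real \<alpha> * of_real c = 1" by simp
  have "\<alpha> * (1 / 6 - 1 / 8) + \<alpha> * (c / 2 - c\<^sup>2 / 2) = sigma2 \<alpha>"
    using \<alpha> by (simp add: c_def sigma2_def field_simps power2_eq_square)
  then have "complex_of_real (\<alpha> * (1 / 6 - 1 / 8) + \<alpha> * (c / 2 - c\<^sup>2 / 2)) = of_real (sigma2 \<alpha>)" by (simp only:)
  then have quad: "complex_of_real (sigma2 \<alpha>) = of_real \<alpha> * (1 / 6 - 1 / 8) + of_real \<alpha> * (of_real c / 2 - (of_real c)\<^sup>2 / 2)"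
    by simp
  have "of_real \<alpha> * (LE - ((- 1 / 2) * s + (1 / 6 - (- 1 / 2)\<^sup>2 / 2) * s\<^sup>2))
      + of_real \<alpha> * (LV - ((- of_real c) * s + (of_real c / 2 - (- of_real c)\<^sup>2 / 2) * s\<^sup>2))
    = of_real \<alpha> * LE + of_real \<alpha> * LV + (of_real \<alpha> * (1 / 2) + of_real \<alpha> * of_real c) * s
      - (of_real \<alpha> * (1 / 6 - 1 / 8) + of_real \<alpha> * (of_real c / 2 - (of_real c)\<^sup>2 / 2)) * s\<^sup>2"
    by (simp add: algebra_simps power_one_over)
  then show ?thesis unfolding lin quad by simp
qed

text \<open>
  The symbol of the error divided by \<open>s\<^sup>\<alpha>\<close>. Dividing each base \<open>1 - e\<^sup>-\<^sup>s\<close> by \<open>s\<close>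
  removes the branch point at \<open>s = 0\<close>.
\<close>

lemma normalized_symbol_expansion:
  "(\<lambda>s. exp s * ((1 - exp (- s)) / s) powr of_real \<alpha> * (of_real a + of_real c * exp (- s)) powr of_real \<alpha>
      - (1 + of_real (sigma2 \<alpha>) * (exp s - 2 + exp (- s)))) \<in> O[at (0::complex)](\<lambda>s. s ^ 3)" (is ?expansion)
  and backward_difference_tendsto: "((\<lambda>s::complex. (1 - exp (- s)) / s) \<longlongrightarrow> 1) (at 0)"
proof -
  define E V where "E = (\<lambda>s::complex. (1 - exp (- s)) / s)" and "V = (\<lambda>s::complex. of_real a + of_real c * exp (- s))"
  define \<sigma> where "\<sigma> = complex_of_real (sigma2 \<alpha>)"
  have ac: "complex_of_real a = 1 - of_real c"
    using gen2_coeffs(3)[OF \<alpha>] unfolding a_def c_def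
    by (metis add_diff_cancel_right' of_real_1 of_real_diff)
  have wE: "(\<lambda>s. (E s - 1) - ((- 1 / 2) * s + (1 / 6) * s\<^sup>2)) \<in> O[at 0](\<lambda>s. s ^ 3)"
    unfolding E_def by (rule backward_difference_expansion)
  have wV: "(\<lambda>s. (V s - 1) - ((- of_real c) * s + (of_real c / 2) * s\<^sup>2)) \<in> O[at 0](\<lambda>s. s ^ 3)"
  proof -
    have "(\<lambda>s::complex. of_real c * (exp (- s) - (1 - s + s\<^sup>2 / 2))) \<in> O[at 0](\<lambda>s. s ^ 3)"
    proof (subst landau_o.big.cmult_in_iff)
      show "complex_of_real c \<noteq> 0" using gen2_coeffs(1)[OF \<alpha>] unfolding c_def of_real_eq_0_iff by (rule less_imp_neq[symmetric])
    qed (rule exp_expansions(2))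
    also have "(\<lambda>s::complex. of_real c * (exp (- s) - (1 - s + s\<^sup>2 / 2)))
       = (\<lambda>s. (V s - 1) - ((- of_real c) * s + (of_real c / 2) * s\<^sup>2))"
      by (simp add: fun_eq_iff V_def algebra_simps ac)
    finally show ?thesis .
  qed
  note LE = Ln_expansion[OF wE] and LV = Ln_expansion[OF wV]
  have limE: "(E \<longlongrightarrow> 1) (at 0)" using tendsto_add[OF LE(2) tendsto_const[of 1]] by simp
  have limV: "(V \<longlongrightarrow> 1) (at 0)" using tendsto_add[OF LV(2) tendsto_const[of 1]] by simp
  show "((\<lambda>s::complex. (1 - exp (- s)) / s) \<longlongrightarrow> 1) (at 0)" using limE by (simp add: E_def)
  define p where "p s = s + of_real \<alpha> * Ln (E s) + of_real \<alpha> * Ln (V s)" for s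
  have p: "(\<lambda>s. p s - \<sigma> * s\<^sup>2) \<in> O[at 0](\<lambda>s. s ^ 3)"
    unfolding p_def \<sigma>_def log_symbol_identity
    using LE(1) LV(1) \<alpha> by (intro sum_in_bigo) (simp_all add: add.commute)
  have s2: "(\<lambda>s::complex. \<sigma> * s\<^sup>2) \<in> O[at 0](\<lambda>s. s ^ 2)"
    by (rule bigoI[where c = "norm \<sigma>"]) (simp add: norm_mult)
  have "(\<lambda>s. (p s - \<sigma> * s\<^sup>2) + \<sigma> * s\<^sup>2) \<in> O[at 0](\<lambda>s. s ^ 2)"
    by (intro sum_in_bigo s2 landau_o.big_trans[OF p power_bigo_power]) simp
  then have p2: "p \<in> O[at 0](\<lambda>s. s ^ 2)" by simp
  have "(\<lambda>s::complex. (exp s - (1 + s + s\<^sup>2 / 2)) + (exp (- s) - (1 - s + s\<^sup>2 / 2))) \<in> O[at 0](\<lambda>s. s ^ 3)"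
    by (intro sum_in_bigo exp_expansions)
  also have "(\<lambda>s::complex. (exp s - (1 + s + s\<^sup>2 / 2)) + (exp (- s) - (1 - s + s\<^sup>2 / 2)))
     = (\<lambda>s. exp s - 2 + exp (- s) - s\<^sup>2)"
    by (simp add: fun_eq_iff algebra_simps)
  finally have cosh: "(\<lambda>s::complex. exp s - 2 + exp (- s) - s\<^sup>2) \<in> O[at 0](\<lambda>s. s ^ 3)" .
  have "(\<lambda>s::complex. \<sigma> * (exp s - 2 + exp (- s) - s\<^sup>2)) \<in> O[at 0](\<lambda>s. s ^ 3)"
    using cosh by (cases "\<sigma> = 0") auto
  then have sum: "(\<lambda>s. (exp (p s) - 1 - p s) + (p s - \<sigma> * s\<^sup>2) - \<sigma> * (exp s - 2 + exp (- s) - s\<^sup>2)) \<in> O[at 0](\<lambda>s. s ^ 3)"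
    by (intro sum_in_bigo exp_minus_1_bigo p2 p)
  have "\<forall>\<^sub>F s in at 0. E s \<noteq> 0" "\<forall>\<^sub>F s in at 0. V s \<noteq> 0"
    using tendsto_imp_eventually_ne[OF limE, of 0] tendsto_imp_eventually_ne[OF limV, of 0] by simp_all
  then have "\<forall>\<^sub>F s in at 0. exp s * E s powr of_real \<alpha> * V s powr of_real \<alpha> - (1 + \<sigma> * (exp s - 2 + exp (- s)))
     = (exp (p s) - 1 - p s) + (p s - \<sigma> * s\<^sup>2) - \<sigma> * (exp s - 2 + exp (- s) - s\<^sup>2)"
  proof eventually_elim
    case (elim s)
    then have "exp (p s) = exp s * E s powr of_real \<alpha> * V s powr of_real \<alpha>"
      by (simp add: p_def exp_add powr_def)
    then show ?case by (simp add: algebra_simps)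
  qed
  then show ?expansion
    unfolding E_def[symmetric] V_def \<sigma>_def[symmetric]
    by (subst landau_o.big.in_cong) (use sum in \<open>auto simp: E_def V_def\<close>)
qed

text \<open>
  Near the origin the estimate is the expansion above on the imaginary axis \<open>s = \<i> \<theta>\<close>. Away
  from it the first term is bounded and the second is \<open>O(\<bar>\<theta>\<bar>\<^sup>\<alpha>)\<close>.
\<close>

lemma symbol_estimate:
  obtains C where "C \<ge> 0" "\<And>\<theta>::real. norm (cis \<theta> * ((1 - cis (- \<theta>)) powr of_real \<alpha> * (of_real a + of_real c * cis (- \<theta>)) powr of_real \<alpha>)
       - (\<i> * \<theta>) powr of_real \<alpha> * (1 + of_real (sigma2 \<alpha>) * (cis \<theta> - 2 + cis (- \<theta>)))) \<le> C * \<bar>\<theta>\<bar> powr (\<alpha> + 3)"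
proof -
  define K where "K \<theta> = cis \<theta> * ((1 - cis (- \<theta>)) powr of_real \<alpha> * (of_real a + of_real c * cis (- \<theta>)) powr of_real \<alpha>)" for \<theta> :: real
  define R where "R \<theta> = (\<i> * \<theta>) powr of_real \<alpha> * (1 + of_real (sigma2 \<alpha>) * (cis \<theta> - 2 + cis (- \<theta>)))" for \<theta> :: real
  define Q where "Q = (\<lambda>s::complex. exp s * ((1 - exp (- s)) / s) powr of_real \<alpha> * (of_real a + of_real c * exp (- s)) powr of_real \<alpha>
      - (1 + of_real (sigma2 \<alpha>) * (exp s - 2 + exp (- s))))"
  have "Q \<in> O[at 0](\<lambda>s. s ^ 3)" unfolding Q_def by (rule normalized_symbol_expansion)
  then obtain C0 where C0: "C0 > 0" "\<forall>\<^sub>F s in at 0. norm (Q s) \<le> C0 * norm (s ^ 3)"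
    by (rule landau_o.bigE)
  have "\<forall>\<^sub>F s::complex in at 0. dist ((1 - exp (- s)) / s) 1 < 1"
    using tendstoD[OF backward_difference_tendsto, of 1] by simp
  with C0(2) have "\<forall>\<^sub>F s in at 0. norm (Q s) \<le> C0 * norm (s ^ 3) \<and> dist ((1 - exp (- s)) / s) 1 < 1"
    by (rule eventually_conj)
  then obtain d where d: "d > 0" "\<And>s. s \<noteq> 0 \<Longrightarrow> norm s < d \<Longrightarrow> norm (Q s) \<le> C0 * norm (s ^ 3) \<and> dist ((1 - exp (- s)) / s) 1 < 1"
    unfolding eventually_at by (auto simp: dist_norm)
  define C where "C = C0 + 2 powr \<alpha> / d powr (\<alpha> + 3) + (1 + 4 * \<bar>sigma2 \<alpha>\<bar>) / d ^ 3"
  have C_nonneg: "C \<ge> 0" using C0 d by (auto simp: C_def)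
  have "norm (K \<theta> - R \<theta>) \<le> C * \<bar>\<theta>\<bar> powr (\<alpha> + 3)" for \<theta>
  proof -
    consider "\<theta> = 0" | "\<theta> \<noteq> 0" "\<bar>\<theta>\<bar> < d" | "\<bar>\<theta>\<bar> \<ge> d" by linarith
    then show ?thesis
    proof cases
      case 1
      then show ?thesis by (simp add: K_def R_def)
    next
      case 2
      define s where "s = \<i> * complex_of_real \<theta>"
      have s: "s \<noteq> 0" "norm s = \<bar>\<theta>\<bar>" using 2 by (auto simp: s_def norm_mult)
      have ex: "exp s = cis \<theta>" "exp (- s) = cis (- \<theta>)" by (auto simp: s_def cis_conv_exp)
      define E where "E = (1 - exp (- s)) / s"
      have Q: "norm (Q s) \<le> C0 * \<bar>\<theta>\<bar> ^ 3" and "dist E 1 < 1"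
        using d(2)[of s] s 2 by (auto simp: norm_power E_def)
      then have "Re E > 0" using abs_Re_le_cmod[of "E - 1"] by (auto simp: dist_norm)
      moreover have "1 - exp (- s) = s * E" using s by (simp add: E_def)
      ultimately have "(1 - exp (- s)) powr of_real \<alpha> = s powr of_real \<alpha> * E powr of_real \<alpha>"
        using s by (simp add: powr_mult_Re_pos s_def)
      then have "K \<theta> - R \<theta> = s powr of_real \<alpha> * Q s"
        unfolding K_def R_def Q_def ex[symmetric] E_def[symmetric] by (simp add: s_def[symmetric] algebra_simps)
      then have "norm (K \<theta> - R \<theta>) = \<bar>\<theta>\<bar> powr \<alpha> * norm (Q s)"
        using s by (simp add: norm_mult norm_powr_real_powr')
      also have "\<dots> \<le> \<bar>\<theta>\<bar> powr \<alpha> * (C0 * \<bar>\<theta>\<bar> ^ 3)"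
        by (intro mult_left_mono Q) auto
      also have "\<dots> = C0 * \<bar>\<theta>\<bar> powr (\<alpha> + 3)"
        using 2 by (simp add: powr_add)
      also have "\<dots> \<le> C * \<bar>\<theta>\<bar> powr (\<alpha> + 3)"
        using C0 d by (intro mult_right_mono) (auto simp: C_def)
      finally show ?thesis .
    next
      case 3
      define x where "x = \<bar>\<theta>\<bar> / d"
      have x: "x \<ge> 1" using 3 d by (simp add: x_def)
      have ac: "0 < c" "0 < a" "a + c = 1"
        using gen2_coeffs[OF \<alpha>] unfolding a_def c_def by linarith+
      have f1: "norm (1 - cis (- \<theta>)) powr \<alpha> \<le> 2 powr \<alpha>"
        using norm_triangle_ineq4[of 1 "cis (- \<theta>)"] \<alpha> by (intro powr_mono2) auto
      have "norm (of_real a + of_real c * cis (- \<theta>)) \<le> 1"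
        using norm_triangle_ineq[of "of_real a" "of_real c * cis (- \<theta>)"] ac by (simp add: norm_mult)
      then have f2: "norm (of_real a + of_real c * cis (- \<theta>)) powr \<alpha> \<le> 1 powr \<alpha>"
        using \<alpha> by (intro powr_mono2) auto
      have "norm (K \<theta>) = norm (1 - cis (- \<theta>)) powr \<alpha> * norm (of_real a + of_real c * cis (- \<theta>)) powr \<alpha>"
        by (simp add: K_def norm_mult norm_powr_real_powr')
      also have "\<dots> \<le> 2 powr \<alpha> * 1"
        using mult_mono[OF f1 f2] by simp
      also have "\<dots> \<le> 2 powr \<alpha> * x powr (\<alpha> + 3)"
        using x \<alpha> by (intro mult_left_mono ge_one_powr_ge_zero) auto
      also have "\<dots> = 2 powr \<alpha> / d powr (\<alpha> + 3) * \<bar>\<theta>\<bar> powr (\<alpha> + 3)"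
        using d by (simp add: x_def powr_divide)
      finally have K: "norm (K \<theta>) \<le> 2 powr \<alpha> / d powr (\<alpha> + 3) * \<bar>\<theta>\<bar> powr (\<alpha> + 3)" .
      have "norm (cis \<theta> - 2 + cis (- \<theta>)) \<le> 4"
        using norm_triangle_ineq[of "cis \<theta> - 2" "cis (- \<theta>)"] norm_triangle_ineq4[of "cis \<theta>" 2] by simp
      then have "norm (1 + of_real (sigma2 \<alpha>) * (cis \<theta> - 2 + cis (- \<theta>))) \<le> 1 + \<bar>sigma2 \<alpha>\<bar> * 4"
        by (intro norm_triangle_le add_mono) (auto simp: norm_mult intro!: mult_left_mono)
      then have "norm (R \<theta>) \<le> \<bar>\<theta>\<bar> powr \<alpha> * (1 + 4 * \<bar>sigma2 \<alpha>\<bar>)"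
        unfolding R_def norm_mult[of "(\<i> * \<theta>) powr of_real \<alpha>"]
        by (intro mult_mono) (auto simp: norm_powr_real_powr' norm_mult)
      also have "\<dots> \<le> \<bar>\<theta>\<bar> powr \<alpha> * (1 + 4 * \<bar>sigma2 \<alpha>\<bar>) * x ^ 3"
        using x mult_left_mono[of 1 "x ^ 3" "\<bar>\<theta>\<bar> powr \<alpha> * (1 + 4 * \<bar>sigma2 \<alpha>\<bar>)"] by simp
      also have "\<dots> = (1 + 4 * \<bar>sigma2 \<alpha>\<bar>) / d ^ 3 * \<bar>\<theta>\<bar> powr (\<alpha> + 3)"
        using 3 d by (simp add: x_def powr_add power_divide)
      finally have R: "norm (R \<theta>) \<le> (1 + 4 * \<bar>sigma2 \<alpha>\<bar>) / d ^ 3 * \<bar>\<theta>\<bar> powr (\<alpha> + 3)" .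
      have "norm (K \<theta> - R \<theta>) \<le> norm (K \<theta>) + norm (R \<theta>)" by (rule norm_triangle_ineq4)
      also have "\<dots> \<le> (2 powr \<alpha> / d powr (\<alpha> + 3) + (1 + 4 * \<bar>sigma2 \<alpha>\<bar>) / d ^ 3) * \<bar>\<theta>\<bar> powr (\<alpha> + 3)"
        using K R by (simp only: distrib_right)
      also have "\<dots> \<le> C * \<bar>\<theta>\<bar> powr (\<alpha> + 3)"
        using C0 by (intro mult_right_mono) (auto simp: C_def)
      finally show ?thesis .
    qed
  qed
  with C_nonneg show ?thesis unfolding K_def R_def by (rule that)
qed

end

section \<open>The operators as Fourier multipliers, and the error\<close>

context fourier_representation
begin

text \<open>
  \<open>J\<close>, the fractional integral of order \<open>2 - \<alpha>\<close> up to the factor \<open>\<Gamma>(2 - \<alpha>)\<close>, is twice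
  differentiable in the classical sense, so \<open>deriv\<close> in the definition of the Riemann-Liouville
  derivatives takes its intended value.
\<close>

lemma frac_integral_derivs:
  assumes \<alpha>: "1 < \<alpha>" "\<alpha> < 2"
  defines "J \<equiv> \<lambda>y. set_lebesgue_integral lborel {..y} (\<lambda>s. u s / (y - s) powr (\<alpha> - 1))"
  obtains J1 where "\<And>y. (J has_real_derivative J1 y) (at y)"
    and "\<And>y. (J1 has_real_derivative
           Gamma (2 - \<alpha>) * Re (LINT w|lborel. \<phi> w * ((\<i> * w) powr of_real \<alpha> * cis (w * y)))) (at y)"
proof -
  define g where "g = 2 - \<alpha>"
  have g: "0 < g" "g < 1" using \<alpha> by (auto simp: g_def)
  \<comment> \<open>the Fourier density of the \<open>j\<close>-th derivative of \<open>J\<close>\<close>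
  define \<psi> where "\<psi> j w = of_real (Gamma g) * (\<phi> w * ((\<i> * of_real w) ^ j * (\<i> * of_real w) powr of_real (- g)))" for j :: nat and w :: real
  have int: "integrable lborel (\<psi> j)" if "j \<le> 2" for j
    unfolding \<psi>_def
  proof (intro integrable_mult_right integrable_density_times[where p = "real j - g" and C = 1])
    show "(\<lambda>w. (\<i> * of_real w) ^ j * (\<i> * of_real w) powr complex_of_real (- g)) \<in> borel_measurable borel"
      using measurable_imaginary_powr[of "- g"] by measurable
    show "norm ((\<i> * of_real w) ^ j * (\<i> * of_real w) powr complex_of_real (- g)) \<le> 1 * \<bar>w\<bar> powr (real j - g)" if "w \<noteq> 0" for w
      unfolding norm_mult norm_power norm_imaginary_powr using that
      by (simp add: powr_diff powr_minus powr_realpow divide_inverse)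
  qed (use g that in auto)
  have step: "\<i> * w * \<psi> j w = \<psi> (Suc j) w" for j w
    by (simp add: \<psi>_def mult_ac)
  define I where "I j y = Re (LINT w|lborel. \<psi> j w * cis (w * y))" for j y
  have deriv: "(I j has_real_derivative I (Suc j) y) (at y)" if "j < 2" for j y
    using has_real_derivative_Re_fourier[of "\<psi> j" y] int[of j] int[of "Suc j"] that
    unfolding I_def step by simp
  have J_eq: "J = I 0"
  proof
    fix y
    have "J y = (LINT s|lborel. indicator {..y} s * (u s / (y - s) powr (\<alpha> - 1)))"
      by (simp add: J_def set_lebesgue_integral_def)
    also have "\<dots> = \<bar>- 1\<bar> *\<^sub>R (LINT t|lborel. indicator {..y} (y + (- 1) * t) * (u (y + (- 1) * t) / (y - (y + (- 1) * t)) powr (\<alpha> - 1)))"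
      by (rule lborel_integral_real_affine) simp
    also have "\<dots> = (LINT t|lborel. indicator {0..} t * t powr (g - 1) * u (y - t))"
      unfolding real_scaleR_def abs_minus_cancel abs_one mult_1
    proof (rule Bochner_Integration.integral_cong[OF refl])
      fix t :: real
      have "1 / t powr (\<alpha> - 1) = t powr (g - 1)"
        using powr_minus_divide[of t "\<alpha> - 1"] by (simp add: g_def)
      then show "indicator {..y} (y + - 1 * t) * (u (y + - 1 * t) / (y - (y + - 1 * t)) powr (\<alpha> - 1)) =
         indicator {0..} t * t powr (g - 1) * u (y - t)"
        by (simp add: indicator_def divide_inverse)
    qed
    finally have "complex_of_real (J y) = of_real (Gamma g) * (LINT w|lborel. \<phi> w * ((\<i> * w) powr of_real (- g) * cis (w * y)))"
      using frac_integral_fourier[OF g, of y] by (simp only:)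
    also have "\<dots> = (LINT w|lborel. \<psi> 0 w * cis (w * y))"
      unfolding integral_mult_right_zero[symmetric] by (simp add: \<psi>_def mult.assoc)
    finally show "J y = I 0 y"
      unfolding I_def by (metis Re_complex_of_real)
  qed
  have \<psi>2: "\<psi> 2 w = of_real (Gamma g) * (\<phi> w * (\<i> * w) powr of_real \<alpha>)" for w
  proof (cases "w = 0")
    case False
    then have "(\<i> * w) ^ 2 * (\<i> * w) powr of_real (- g) = (\<i> * w) powr 2 * (\<i> * w) powr of_real (- g)"
      by simp
    also have "\<dots> = (\<i> * w) powr (2 + of_real (- g))"
      by (rule powr_add[symmetric])
    also have "2 + of_real (- g) = complex_of_real \<alpha>" by (simp add: g_def)
    finally show ?thesis by (simp only: \<psi>_def)
  qed (simp add: \<psi>_def)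
  have I2: "I 2 y = Gamma (2 - \<alpha>) * Re (LINT w|lborel. \<phi> w * ((\<i> * w) powr of_real \<alpha> * cis (w * y)))" for y
    by (simp add: I_def \<psi>2 g_def mult.assoc)
  show ?thesis
  proof (rule that)
    show "(J has_real_derivative I 1 y) (at y)" for y using deriv[of 0 y] by (simp add: J_eq)
    show "(I 1 has_real_derivative
           Gamma (2 - \<alpha>) * Re (LINT w|lborel. \<phi> w * ((\<i> * w) powr of_real \<alpha> * cis (w * y)))) (at y)" for y
      using deriv[of 1 y] by (simp add: I2 numeral_2_eq_2[symmetric])
  qed
qed

lemma RL_left_fourier:
  assumes "1 < \<alpha>" "\<alpha> < 2"
  shows "RL_left \<alpha> u x = Re (LINT w|lborel. \<phi> w * ((\<i> * w) powr of_real \<alpha> * cis (w * x)))"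
proof -
  obtain J1 where J: "\<And>y. ((\<lambda>y. set_lebesgue_integral lborel {..y} (\<lambda>s. u s / (y - s) powr (\<alpha> - 1))) has_real_derivative J1 y) (at y)"
     "\<And>y. (J1 has_real_derivative
           Gamma (2 - \<alpha>) * Re (LINT w|lborel. \<phi> w * ((\<i> * w) powr of_real \<alpha> * cis (w * y)))) (at y)"
    using frac_integral_derivs[OF assms] by blast
  have "deriv (\<lambda>y. set_lebesgue_integral lborel {..y} (\<lambda>s. u s / (y - s) powr (\<alpha> - 1))) = J1"
    using DERIV_imp_deriv[OF J(1)] by (simp add: fun_eq_iff)
  then have "(deriv ^^ 2) (\<lambda>y. set_lebesgue_integral lborel {..y} (\<lambda>s. u s / (y - s) powr (\<alpha> - 1))) x
     = Gamma (2 - \<alpha>) * Re (LINT w|lborel. \<phi> w * ((\<i> * w) powr of_real \<alpha> * cis (w * x)))"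
    using DERIV_imp_deriv[OF J(2)] by (simp add: numeral_2_eq_2)
  moreover have "Gamma (2 - \<alpha>) > 0" using assms by (intro Gamma_real_pos) simp
  ultimately show ?thesis unfolding RL_left_def by (simp only:) simp
qed

text \<open>
  Since \<open>deriv\<close> is arbitrary at points of non-differentiability, reflection commutes with it
  only for differentiable functions, which is where \<open>frac_integral_derivs\<close> enters.
\<close>

lemma RL_right_reflect:
  assumes "1 < \<alpha>" "\<alpha> < 2" and v: "\<And>x. v x = u (- x)"
  shows "RL_right \<alpha> v x = RL_left \<alpha> u (- x)"
proof -
  define J where "J = (\<lambda>y. set_lebesgue_integral lborel {..y} (\<lambda>s. u s / (y - s) powr (\<alpha> - 1)))"
  define J2 where "J2 y = Gamma (2 - \<alpha>) * Re (LINT w|lborel. \<phi> w * ((\<i> * w) powr of_real \<alpha> * cis (w * y)))" for y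
  obtain J1 where J: "\<And>y. (J has_real_derivative J1 y) (at y)" "\<And>y. (J1 has_real_derivative J2 y) (at y)"
    using frac_integral_derivs[OF assms(1,2)] unfolding J_def J2_def by blast
  have dJ: "deriv J = J1" using DERIV_imp_deriv[OF J(1)] by (simp add: fun_eq_iff)
  have eq: "(\<lambda>y. set_lebesgue_integral lborel {y..} (\<lambda>s. v s / (s - y) powr (\<alpha> - 1))) = (\<lambda>y. J (- y))"
  proof
    fix y
    have "set_lebesgue_integral lborel {y..} (\<lambda>s. v s / (s - y) powr (\<alpha> - 1))
       = (LINT s|lborel. indicator {y..} s * (v s / (s - y) powr (\<alpha> - 1)))"
      by (simp add: set_lebesgue_integral_def)
    also have "\<dots> = \<bar>- 1\<bar> *\<^sub>R (LINT s|lborel. indicator {y..} (0 + (- 1) * s) * (v (0 + (- 1) * s) / ((0 + (- 1) * s) - y) powr (\<alpha> - 1)))"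
      by (rule lborel_integral_real_affine) simp
    also have "\<dots> = (LINT s|lborel. indicator {.. - y} s * (u s / (- y - s) powr (\<alpha> - 1)))"
      unfolding real_scaleR_def abs_minus_cancel abs_one mult_1
      by (intro Bochner_Integration.integral_cong refl) (auto simp: indicator_def v minus_diff_commute)
    finally show "set_lebesgue_integral lborel {y..} (\<lambda>s. v s / (s - y) powr (\<alpha> - 1)) = J (- y)"
      by (simp add: J_def set_lebesgue_integral_def)
  qed
  have "((\<lambda>y. J (- y)) has_real_derivative - J1 (- y)) (at y)" for y
    using J(1)[of "- y"] by (simp only: DERIV_mirror)
  then have d1: "deriv (\<lambda>y. J (- y)) = (\<lambda>y. - J1 (- y))"
    by (simp add: fun_eq_iff DERIV_imp_deriv)
  have "((\<lambda>y. - J1 (- y)) has_real_derivative J2 (- x)) (at x)"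
    using J(2)[of "- x"] DERIV_minus by (fastforce simp: DERIV_mirror)
  then have "(deriv ^^ 2) (\<lambda>y. J (- y)) x = J2 (- x)"
    by (simp add: numeral_2_eq_2 d1 DERIV_imp_deriv)
  moreover have "(deriv ^^ 2) J (- x) = J2 (- x)"
    using DERIV_imp_deriv[OF J(2)] by (simp add: numeral_2_eq_2 dJ)
  ultimately show ?thesis
    unfolding RL_right_def RL_left_def eq J_def[symmetric] by (simp only:)
qed

lemma L_op_RL_left_fourier:
  assumes "1 < \<alpha>" "\<alpha> < 2" "h > 0"
  shows "L_op \<alpha> h (RL_left \<alpha> u) x = Re (LINT w|lborel. \<phi> w * (\<i> * w) powr of_real \<alpha> *
           (1 + of_real (sigma2 \<alpha>) * (cis (w * h) - 2 + cis (- (w * h)))) * cis (w * x))"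
    and "integrable lborel (\<lambda>w. \<phi> w * (\<i> * w) powr of_real \<alpha> *
           (1 + of_real (sigma2 \<alpha>) * (cis (w * h) - 2 + cis (- (w * h)))) * cis (w * x))"
proof -
  define f where "f y w = \<phi> w * ((\<i> * complex_of_real w) powr of_real \<alpha> * cis (w * y))" for y w
  have int: "integrable lborel (f y)" for y
    unfolding f_def
  proof (rule integrable_density_times[where p = \<alpha> and C = 1])
    show "(\<lambda>w. (\<i> * complex_of_real w) powr of_real \<alpha> * cis (w * y)) \<in> borel_measurable borel"
      using measurable_imaginary_powr[of \<alpha>] by measurable
  qed (use assms in \<open>auto simp: norm_mult norm_imaginary_powr\<close>)
  have eq: "\<phi> w * (\<i> * w) powr of_real \<alpha> *
           (1 + of_real (sigma2 \<alpha>) * (cis (w * h) - 2 + cis (- (w * h)))) * cis (w * x)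
     = f x w + of_real (sigma2 \<alpha>) * (f (x + h) w - 2 * f x w + f (x - h) w)" for w
  proof -
    have "cis (w * (x + h)) = cis (w * h) * cis (w * x)" "cis (w * (x - h)) = cis (- (w * h)) * cis (w * x)"
      by (simp_all add: cis_mult algebra_simps)
    then show ?thesis by (simp add: f_def algebra_simps)
  qed
  show "integrable lborel (\<lambda>w. \<phi> w * (\<i> * w) powr of_real \<alpha> *
           (1 + of_real (sigma2 \<alpha>) * (cis (w * h) - 2 + cis (- (w * h)))) * cis (w * x))"
    unfolding eq using int by (intro Bochner_Integration.integrable_add Bochner_Integration.integrable_diff integrable_mult_right)
  have "(LINT w|lborel. f x w + of_real (sigma2 \<alpha>) * (f (x + h) w - 2 * f x w + f (x - h) w))
      = (LINT w|lborel. f x w) + of_real (sigma2 \<alpha>) * ((LINT w|lborel. f (x + h) w) - 2 * (LINT w|lborel. f x w) + (LINT w|lborel. f (x - h) w))"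
    using int by (simp add: Bochner_Integration.integral_add Bochner_Integration.integral_diff)
  moreover have "L_op \<alpha> h (RL_left \<alpha> u) x = Re ((LINT w|lborel. f x w) +
      of_real (sigma2 \<alpha>) * ((LINT w|lborel. f (x + h) w) - 2 * (LINT w|lborel. f x w) + (LINT w|lborel. f (x - h) w)))"
    using assms by (simp add: L_op_def delta2_def RL_left_fourier f_def)
  ultimately show "L_op \<alpha> h (RL_left \<alpha> u) x = Re (LINT w|lborel. \<phi> w * (\<i> * w) powr of_real \<alpha> *
           (1 + of_real (sigma2 \<alpha>) * (cis (w * h) - 2 + cis (- (w * h)))) * cis (w * x))"
    unfolding eq by simp
qed

text \<open>
  \<open>K \<theta>\<close> is \<open>e\<^sup>s W(e\<^sup>-\<^sup>s)\<^sup>\<alpha>\<close> at \<open>s = \<i> \<theta>\<close>, with \<open>W\<close> factored; the factor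
  \<open>e\<^sup>s\<close> comes from the shift by one grid point in \<open>B2_left\<close>.
\<close>

lemma B2_left_fourier:
  fixes \<alpha> h :: real
  assumes \<alpha>: "1 < \<alpha>" "\<alpha> < 2"
  defines "K \<equiv> \<lambda>\<theta>. cis \<theta> * ((1 - cis (- \<theta>)) powr of_real \<alpha> *
      (of_real ((3 * \<alpha> - 2) / (2 * \<alpha>)) + of_real ((2 - \<alpha>) / (2 * \<alpha>)) * cis (- \<theta>)) powr of_real \<alpha>)"
  shows "B2_left \<alpha> h u x = 1 / h powr \<alpha> * Re (LINT w|lborel. \<phi> w * (K (w * h) * cis (w * x)))"
    and "integrable lborel (\<lambda>w. \<phi> w * (K (w * h) * cis (w * x)))"
proof -
  define f where "f l w = of_real (kappa2 \<alpha> l) * (\<phi> w * cis (w * (x - (real l - 1) * h)))" for l w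
  have f_int: "integrable lborel (f l)" for l
    unfolding f_def by (intro integrable_mult_right integrable_density_cis)
  have norm_f: "norm (f l w) = \<bar>kappa2 \<alpha> l\<bar> * norm (\<phi> w)" for l w
    by (simp add: f_def norm_mult)
  have sums_f: "(\<lambda>l. f l w) sums (\<phi> w * (K (w * h) * cis (w * x)))" for w
  proof -
    have "(\<lambda>l. (\<phi> w * cis (w * x) * cis (w * h)) * (of_real (kappa2 \<alpha> l) * cis (- (w * h)) ^ l))
       sums ((\<phi> w * cis (w * x) * cis (w * h)) * ((1 - cis (- (w * h))) powr of_real \<alpha> *
      (of_real ((3 * \<alpha> - 2) / (2 * \<alpha>)) + of_real ((2 - \<alpha>) / (2 * \<alpha>)) * cis (- (w * h))) powr of_real \<alpha>))"
      by (intro sums_mult kappa2_sums_closed_disc \<alpha>) simp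
    also have "(\<lambda>l. (\<phi> w * cis (w * x) * cis (w * h)) * (of_real (kappa2 \<alpha> l) * cis (- (w * h)) ^ l)) = (\<lambda>l. f l w)"
    proof
      fix l
      have "cis (w * (x - (real l - 1) * h)) = cis (w * x) * cis (w * h) * cis (- (w * h)) ^ l"
        unfolding Complex.DeMoivre cis_mult by (rule arg_cong[of _ _ cis]) (simp add: algebra_simps)
      then show "(\<phi> w * cis (w * x) * cis (w * h)) * (of_real (kappa2 \<alpha> l) * cis (- (w * h)) ^ l) = f l w"
        by (simp add: f_def)
    qed
    finally show ?thesis by (simp add: K_def mult_ac)
  qed
  have sum_norm: "AE w in lborel. summable (\<lambda>l. norm (f l w))"
    unfolding norm_f by (intro AE_I2 summable_mult2 kappa2_summable \<alpha>)
  have sum_int: "summable (\<lambda>l. LINT w|lborel. norm (f l w))"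
    unfolding norm_f integral_mult_right_zero by (intro summable_mult2 kappa2_summable \<alpha>)
  have eq: "(\<lambda>w. \<Sum>l. f l w) = (\<lambda>w. \<phi> w * (K (w * h) * cis (w * x)))"
    using sums_unique[OF sums_f] by (simp add: fun_eq_iff)
  show "integrable lborel (\<lambda>w. \<phi> w * (K (w * h) * cis (w * x)))"
    using integrable_suminf[OF f_int sum_norm sum_int] by (simp add: eq)
  have "(\<lambda>l. LINT w|lborel. f l w) sums (LINT w|lborel. \<phi> w * (K (w * h) * cis (w * x)))"
    using sums_integral[OF f_int sum_norm sum_int] by (simp add: eq)
  moreover have "(LINT w|lborel. f l w) = of_real (kappa2 \<alpha> l * u (x - (real l - 1) * h))" for l
    by (simp add: f_def representation del: of_real_diff)
  ultimately have "(\<lambda>l. complex_of_real (kappa2 \<alpha> l * u (x - (real l - 1) * h))) sums (LINT w|lborel. \<phi> w * (K (w * h) * cis (w * x)))"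
    by simp
  from sums_Re[OF this] have "(\<lambda>l. kappa2 \<alpha> l * u (x - (real l - 1) * h)) sums Re (LINT w|lborel. \<phi> w * (K (w * h) * cis (w * x)))"
    by simp
  then show "B2_left \<alpha> h u x = 1 / h powr \<alpha> * Re (LINT w|lborel. \<phi> w * (K (w * h) * cis (w * x)))"
    unfolding B2_left_def by (simp add: sums_iff)
qed

lemma B2_left_error:
  assumes \<alpha>: "1 < \<alpha>" "\<alpha> < 2"
  obtains C where "\<And>h x. h > 0 \<Longrightarrow> \<bar>B2_left \<alpha> h u x - L_op \<alpha> h (RL_left \<alpha> u) x\<bar> \<le> C * h ^ 3"
proof -
  define K where "K = (\<lambda>\<theta>. cis \<theta> * ((1 - cis (- \<theta>)) powr of_real \<alpha> *
      (of_real ((3 * \<alpha> - 2) / (2 * \<alpha>)) + of_real ((2 - \<alpha>) / (2 * \<alpha>)) * cis (- \<theta>)) powr of_real \<alpha>))"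
  define P where "P \<theta> = 1 + of_real (sigma2 \<alpha>) * (cis \<theta> - 2 + cis (- \<theta>))" for \<theta>
  obtain C where C: "C \<ge> 0" "\<And>\<theta>::real. norm (K \<theta> - (\<i> * \<theta>) powr of_real \<alpha> * P \<theta>) \<le> C * \<bar>\<theta>\<bar> powr (\<alpha> + 3)"
    using symbol_estimate[OF \<alpha>] unfolding K_def P_def by blast
  define N where "N = (LINT w|lborel. norm (\<phi> w * of_real (\<bar>w\<bar> powr (\<alpha> + 3))))"
  have N_int: "integrable lborel (\<lambda>w. \<phi> w * of_real (\<bar>w\<bar> powr (\<alpha> + 3)))"
    by (rule integrable_density_times[where p = "\<alpha> + 3" and C = 1]) (use \<alpha> in auto)
  have "\<bar>B2_left \<alpha> h u x - L_op \<alpha> h (RL_left \<alpha> u) x\<bar> \<le> (C * N) * h ^ 3" if h: "h > 0" for h x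
  proof -
    define A where "A w = \<phi> w * (K (w * h) * cis (w * x))" for w
    define B where "B w = \<phi> w * (\<i> * w) powr of_real \<alpha> * P (w * h) * cis (w * x)" for w :: real
    have A: "B2_left \<alpha> h u x = 1 / h powr \<alpha> * Re (LINT w|lborel. A w)" "integrable lborel A"
      unfolding A_def K_def by (rule B2_left_fourier[OF \<alpha>])+
    have B: "L_op \<alpha> h (RL_left \<alpha> u) x = Re (LINT w|lborel. B w)" "integrable lborel B"
      unfolding B_def P_def by (rule L_op_RL_left_fourier[OF \<alpha> h])+
    define D where "D w = of_real (1 / h powr \<alpha>) * A w - B w" for w
    have D_int: "integrable lborel D"
      unfolding D_def using A B by (intro Bochner_Integration.integrable_diff integrable_mult_right)
    have "(LINT w|lborel. D w) = of_real (1 / h powr \<alpha>) * (LINT w|lborel. A w) - (LINT w|lborel. B w)"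
      unfolding D_def using A B by (subst Bochner_Integration.integral_diff) (auto simp del: of_real_divide)
    then have "B2_left \<alpha> h u x - L_op \<alpha> h (RL_left \<alpha> u) x = Re (LINT w|lborel. D w)"
      unfolding A(1) B(1) by (simp only: minus_complex.sel Re_complex_of_real times_complex.sel Im_complex_of_real)
    then have "\<bar>B2_left \<alpha> h u x - L_op \<alpha> h (RL_left \<alpha> u) x\<bar> \<le> norm (LINT w|lborel. D w)"
      using abs_Re_le_cmod by simp
    also have "\<dots> \<le> (LINT w|lborel. norm (D w))" by (rule integral_norm_bound)
    also have "\<dots> \<le> (LINT w|lborel. (C * h ^ 3) * norm (\<phi> w * of_real (\<bar>w\<bar> powr (\<alpha> + 3))))"
    proof (rule integral_mono)
      fix w :: real
      have "(\<i> * complex_of_real (w * h)) powr of_real \<alpha> = (of_real h * (\<i> * w)) powr of_real \<alpha>"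
        by (simp add: mult_ac)
      also have "\<dots> = of_real (h powr \<alpha>) * (\<i> * w) powr of_real \<alpha>"
        using h by (subst powr_times_real_left) (auto simp: powr_of_real)
      finally have "D w = of_real (1 / h powr \<alpha>) * (\<phi> w * cis (w * x) * (K (w * h) - (\<i> * complex_of_real (w * h)) powr of_real \<alpha> * P (w * h)))"
        using h by (simp add: D_def A_def B_def field_simps)
      then have "norm (D w) = 1 / h powr \<alpha> * (norm (\<phi> w) * norm (K (w * h) - (\<i> * complex_of_real (w * h)) powr of_real \<alpha> * P (w * h)))"
        by (simp only: norm_mult norm_cis norm_of_real) simp
      also have "\<dots> \<le> 1 / h powr \<alpha> * (norm (\<phi> w) * (C * \<bar>w * h\<bar> powr (\<alpha> + 3)))"
        by (intro mult_left_mono C) auto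
      also have "\<bar>w * h\<bar> powr (\<alpha> + 3) = \<bar>w\<bar> powr (\<alpha> + 3) * (h powr \<alpha> * h ^ 3)"
        using h by (simp add: abs_mult powr_mult powr_add)
      also have "1 / h powr \<alpha> * (norm (\<phi> w) * (C * (\<bar>w\<bar> powr (\<alpha> + 3) * (h powr \<alpha> * h ^ 3))))
         = (C * h ^ 3) * norm (\<phi> w * of_real (\<bar>w\<bar> powr (\<alpha> + 3)))"
        using h by (simp add: norm_mult)
      finally show "norm (D w) \<le> (C * h ^ 3) * norm (\<phi> w * of_real (\<bar>w\<bar> powr (\<alpha> + 3)))" .
    qed (use D_int N_int in \<open>auto intro!: integrable_mult_right integrable_norm\<close>)
    also have "\<dots> = (C * N) * h ^ 3" by (simp add: N_def)
    finally show ?thesis .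
  qed
  then show ?thesis by (rule that)
qed

lemma fourier_representation_reflect:
  "fourier_representation (\<lambda>x. u (- x)) (\<lambda>w. \<phi> (- w)) M"
proof
  show "integrable lborel (\<lambda>x. u (- x))"
    using lborel_integrable_real_affine[OF u_integrable, of "-1" 0] by simp
  show "norm (\<phi> (- w)) \<le> M / (1 + \<bar>w\<bar>) ^ 6" for w using density_decay[of "-w"] by simp
  show "of_real (u (- x)) = (LINT w|lborel. \<phi> (- w) * cis (w * x))" for x
    unfolding representation
    by (subst lborel_integral_real_affine[where c = "-1" and t = 0]) auto
qed measurable

end

lemma derivs_in_L1_fourier_representation:
  assumes "derivs_in_L1 6 u"
  obtains \<phi> M where "fourier_representation u \<phi> M"
proof -
  note u = derivs_in_L1_bounded_continuous[of 5 u, simplified, OF assms]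
  obtain B where B: "\<And>x. \<bar>u x\<bar> \<le> B" using u(2) by blast
  obtain M where M: "\<And>w. norm (fourier u w) \<le> M / (1 + \<bar>w\<bar>) ^ 6"
    using derivs_in_L1_fourier_decay[OF assms] by blast
  have meas: "fourier u \<in> borel_measurable borel"
    using u(3) by (intro borel_measurable_fourier) auto
  have "M \<ge> 0" using order_trans[OF norm_ge_zero M[of 0]] by simp
  have "integrable lborel (\<lambda>w::real. M * (\<bar>w\<bar> powr 0 / (1 + \<bar>w\<bar>) ^ 6))"
    by (intro integrable_mult_right integrable_powr_weight) auto
  then have int: "integrable lborel (fourier u)"
  proof (rule Bochner_Integration.integrable_bound)
    show "AE w in lborel. norm (fourier u w) \<le> norm (M * (\<bar>w\<bar> powr 0 / (1 + \<bar>w\<bar>) ^ 6))"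
      \<comment> \<open>\<open>w = 0\<close> is excluded because \<open>0 powr 0 = 0\<close>\<close>
      using AE_lborel_singleton[of "0::real"]
    proof eventually_elim
      case (elim w)
      then show ?case using M[of w] \<open>M \<ge> 0\<close> by simp
    qed
  qed (use meas in simp)
  have "fourier_representation u (\<lambda>w. of_real (1 / (2 * pi)) * fourier u w) (M / (2 * pi))"
  proof
    show "norm (of_real (1 / (2 * pi)) * fourier u w) \<le> M / (2 * pi) / (1 + \<bar>w\<bar>) ^ 6" for w
      unfolding norm_mult norm_of_real using mult_left_mono[OF M[of w], of "1 / (2 * pi)"] by simp
    show "of_real (u x) = (LINT w|lborel. of_real (1 / (2 * pi)) * fourier u w * cis (w * x))" for x
      using fourier_inversion[OF u(3) u(1) B int, of x] by (simp add: mult.assoc)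
    show "(\<lambda>w. of_real (1 / (2 * pi)) * fourier u w) \<in> borel_measurable borel"
      using meas by measurable
  qed (rule u(3))
  then show ?thesis by (rule that)
qed

theorem theorem2p3:
  fixes \<alpha> :: real and u :: "real \<Rightarrow> real"
  assumes "1 < \<alpha>" and "\<alpha> < 2"
    and "C_k (nat \<lfloor>\<alpha>\<rfloor> + 4) u"
    and "derivs_in_L1 (nat \<lfloor>\<alpha>\<rfloor> + 5) u"
  shows "(\<exists>C. \<forall>\<^sub>F h in at_right 0. \<forall>x.
            \<bar>B2_left \<alpha> h u x - L_op \<alpha> h (RL_left \<alpha> u) x\<bar> \<le> C * h ^ 3) \<and>
         (\<exists>C. \<forall>\<^sub>F h in at_right 0. \<forall>x.
            \<bar>B2_right \<alpha> h u x - L_op \<alpha> h (RL_right \<alpha> u) x\<bar> \<le> C * h ^ 3)"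
proof -
  have "\<lfloor>\<alpha>\<rfloor> = 1" using assms by (intro floor_unique) auto
  then have "derivs_in_L1 6 u" using assms by simp
  then obtain \<phi> M where rep: "fourier_representation u \<phi> M"
    by (rule derivs_in_L1_fourier_representation)
  define v where "v x = u (- x)" for x
  have rep': "fourier_representation v (\<lambda>w. \<phi> (- w)) M"
    unfolding v_def using rep by (rule fourier_representation.fourier_representation_reflect)
  have pos: "\<forall>\<^sub>F h::real in at_right 0. h > 0" by (rule eventually_at_right_less)
  obtain C where C: "\<And>h x. h > 0 \<Longrightarrow> \<bar>B2_left \<alpha> h u x - L_op \<alpha> h (RL_left \<alpha> u) x\<bar> \<le> C * h ^ 3"
    using fourier_representation.B2_left_error[OF rep assms(1,2)] by blast
  obtain C' where C': "\<And>h x. h > 0 \<Longrightarrow> \<bar>B2_left \<alpha> h v x - L_op \<alpha> h (RL_left \<alpha> v) x\<bar> \<le> C' * h ^ 3"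
    using fourier_representation.B2_left_error[OF rep' assms(1,2)] by blast
  have RL: "RL_right \<alpha> u y = RL_left \<alpha> v (- y)" for y
    by (rule fourier_representation.RL_right_reflect[OF rep' assms(1,2)]) (simp add: v_def)
  have "B2_right \<alpha> h u x = B2_left \<alpha> h v (- x)" for h x
    by (simp add: B2_right_def B2_left_def v_def algebra_simps)
  moreover have "L_op \<alpha> h (RL_right \<alpha> u) x = L_op \<alpha> h (RL_left \<alpha> v) (- x)" for h x
    by (simp add: L_op_def delta2_def RL algebra_simps minus_diff_commute)
  ultimately have "\<bar>B2_right \<alpha> h u x - L_op \<alpha> h (RL_right \<alpha> u) x\<bar> \<le> C' * h ^ 3" if "h > 0" for h x
    using C'[OF that, of "- x"] by simp
  with C show ?thesis
    by (intro conjI exI[of _ C] exI[of _ C'] eventually_mono[OF pos]) auto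
qed

end
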